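(* Let $\mathfrak a:a_1<\cdots<a_p$ and $\mathfrak b:b_1<\cdots<b_q$ be two sequences of elements of $\mathbb N_\Box=\{\Box,1,2,\ldots\}$ with $a_1\neq1$, and let $w\in\widetilde W_\infty$. Suppose that $w$ and $w^{-1}$ are compatible with $\mathfrak a$ and $\mathfrak b$, respectively. Then the Schubert polynomial $\mathfrak D_w(X;Y,Z)$ satisfies $$\mathfrak D_w=\sum G_{u_1}(0/Z_q)\cdots G_{u_{q-1}}(0/Z_2)\,I_{u_q}(X;Y_1/Z_1)\,G_{u_{q+1}}(Y_2)\cdots G_{u_{p+q-1}}(Y_p)$$ summed over all reduced factorizations $u_1\cdots u_{p+q-1}=w$ compatible with $\mathfrak a,\mathfrak b$.
   Context: $X=(x_1,x_2,\ldots)$, $Y=(y_1,y_2,\ldots)$, $Z=(z_1,z_2,\ldots)$ are commuting independent variables. $\mathbb N_\Box$ is ordered by $\Box<1<2<\cdots$; when used as a numerical index or bound, $\Box$ is treated as $0$. $\widetilde W_n$ is the group of signed permutations of $\{1,\ldots,n\}$ with an even number of sign changes, generated by $s_i=(i,i+1)$, $1\leq i\leq n-1$, and $s_\Box$, which acts on the right by $(w_1,w_2,w_3,\ldots,w_n)s_\Box=(\overline w_2,\overline w_1,w_3,\ldots,w_n)$. $\widetilde W_\infty=\bigcup_n\widetilde W_n$ (adjoining fixed points) and $S_\infty=\bigcup_nS_n\subset\widetilde W_\infty$. $\ell$ is the length with respect to the generators $s_i$, $i\in\mathbb N_\Box$; $w$ has a descent at $r\in\mathbb N_\Box$ if $\ell(ws_r)<\ell(w)$.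 A reduced factorization $u_1\cdots u_m=w$ is one with $\ell(u_1)+\cdots+\ell(u_m)=\ell(w)$. The nilCoxeter algebra of $\widetilde W_n$ is the free associative unital algebra on $u_\Box,u_1,\ldots,u_{n-1}$ modulo $u_i^2=0$ (all $i$); $u_\Box u_1=u_1u_\Box$; $u_\Box u_2u_\Box=u_2u_\Box u_2$; $u_iu_{i+1}u_i=u_{i+1}u_iu_{i+1}$ for $i>0$; and all other pairs of generators commute. It has basis $u_w=u_{a_1}\cdots u_{a_\ell}$, $w\in\widetilde W_n$, for any reduced word of $w$; $\langle\xi,w\rangle$ is the coefficient of $u_w$ in $\xi$. Set $A_i(t)=(1+tu_{n-1})\cdots(1+tu_i)$, $\tilde A_i(t)=(1-tu_i)\cdots(1-tu_{n-1})$, $D(t)=(1+tu_{n-1})\cdots(1+tu_2)(1+tu_1)(1+tu_\Box)(1+tu_2)\cdots(1+tu_{n-1})$, $D(X)=D(x_1)D(x_2)\cdots$, $A(Y)=A_1(y_1)A_1(y_2)\cdots$, $\tilde A(Z)=\tilde A_1(z_1)\tilde A_1(z_2)\cdots$. For $w\in\widetilde W_n$ and $\varpi\in S_n$ define (all independent of $n$): - the type D double Schubert polynomial $\mathfrak D_w(X;Y,Z)=\langle\tilde A_{n-1}(z_{n-1})\cdots\tilde A_1(z_1)D(X)A_1(y_1)\cdots A_{n-1}(y_{n-1}),w\rangle$; - the double Stanley function $G_\varpi(Y/Z)=\langle\tilde A(Z)A(Y),\varpi\rangle$ and $G_\varpi(Y)=\langle A(Y),\varpi\rangle$ (so $G_\varpi(0/Z)=\langle\tilde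 A(Z),\varpi\rangle$); - the double mixed Stanley function $I_w(X;Y/Z)=\langle\tilde A(Z)D(X)A(Y),w\rangle$. These are separately symmetric in each set of variables, so they may be evaluated at finite sets of variables in place of $Y,Z$ (remaining variables set to $0$). Compatibility: $w\in\widetilde W_\infty$ is compatible with $\mathfrak a$ if all descent positions of $w$ are contained in $\mathfrak a$. A reduced factorization $u_1\cdots u_{p+q-1}=w$ is compatible with $\mathfrak a,\mathfrak b$ if $u_i\in S_\infty$ for all $i\neq q$, and $u_j(i)=i$ whenever $j<q$ and $1\leq i\leq b_{q-j}$, or whenever $j>q$ and $1\leq i\leq a_{j-q}$. Here $Y_i=\{y_{a_{i-1}+1},\ldots,y_{a_i}\}$ and $Z_j=\{z_{b_{j-1}+1},\ldots,z_{b_j}\}$ for $i,j\geq1$, with $a_0=b_0=0$ (so $Y_1=\emptyset$ if $a_1=\Box$, and $Z_1=\emptyset$ if $b_1=\Box$). *)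

theory Defs
  imports "HOL-Library.Poly_Mapping" "HOL-Combinatorics.Permutations" Complex_Main
begin

text \<open>Formal power series with integer coefficients in commuting variables indexed by \<^typ>\<open>'v\<close>,
  as functions on monomials (exponent vectors of finite support).\<close>

typedef 'v mps = "UNIV :: (('v \<Rightarrow>\<^sub>0 nat) \<Rightarrow> int) set"
  morphisms mps_nth Abs_mps ..

lemma mps_nth_Abs [simp]: "mps_nth (Abs_mps f) = f"
  by (simp add: Abs_mps_inverse)

lemma mps_eqI: "(\<And>m. mps_nth f m = mps_nth g m) \<Longrightarrow> f = g"
  using mps_nth_inject by blast

definition mon_splits :: "('v \<Rightarrow>\<^sub>0 nat) \<Rightarrow> (('v \<Rightarrow>\<^sub>0 nat) \<times> ('v \<Rightarrow>\<^sub>0 nat)) set" where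
  "mon_splits m = {(a, b). a + b = m}"

lemma finite_mon_splits [simp]: "finite (mon_splits m)"
proof -
  define S where "S = {a. \<exists>b. a + b = m}"
  define F where "F = {f. \<forall>v. (v \<in> Poly_Mapping.keys m \<longrightarrow> f v \<in> {..Max (Poly_Mapping.lookup m ` Poly_Mapping.keys m)})
                        \<and> (v \<notin> Poly_Mapping.keys m \<longrightarrow> f v = 0)}"
  have le: "Poly_Mapping.lookup a v \<le> Poly_Mapping.lookup m v" if "a \<in> S" for a v
    using that by (auto simp: S_def lookup_add)
  have "Poly_Mapping.lookup a \<in> F" if "a \<in> S" for a
    unfolding F_def
  proof (intro CollectI allI conjI impI)
    fix v assume v: "v \<in> Poly_Mapping.keys m"
    have "Poly_Mapping.lookup m v \<le> Max (Poly_Mapping.lookup m ` Poly_Mapping.keys m)"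
      by (intro Max_ge finite_imageI imageI finite_keys v)
    then show "Poly_Mapping.lookup a v \<in> {..Max (Poly_Mapping.lookup m ` Poly_Mapping.keys m)}"
      using le[OF that, of v] by simp
  next
    fix v assume "v \<notin> Poly_Mapping.keys m"
    then show "Poly_Mapping.lookup a v = 0"
      using le[OF that, of v] by (simp add: in_keys_iff)
  qed
  moreover have "finite F"
    unfolding F_def by (rule finite_set_of_finite_funs) simp_all
  ultimately have "finite (Poly_Mapping.lookup ` S)"
    by (meson finite_subset image_subsetI)
  then have "finite S"
    by (rule finite_imageD) (auto intro: inj_onI poly_mapping_eqI)
  moreover have "mon_splits m \<subseteq> S \<times> S"
    unfolding mon_splits_def S_def by (auto intro: add.commute)
  ultimately show ?thesis
    by (auto intro: finite_subset[OF _ finite_cartesian_product])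
qed

lemma sum_mon_splits_swap: "(\<Sum>p\<in>mon_splits m. h (fst p) (snd p)) = (\<Sum>p\<in>mon_splits m. h (snd p) (fst p))"
  by (rule sum.reindex_bij_witness[of _ prod.swap prod.swap])
    (auto simp: mon_splits_def add.commute)

lemma sum_mon_splits_assoc:
  "(\<Sum>p\<in>mon_splits m. \<Sum>r\<in>mon_splits (fst p). h (fst r) (snd r) (snd p)) =
   (\<Sum>p\<in>mon_splits m. \<Sum>r\<in>mon_splits (snd p). h (fst p) (fst r) (snd r))"
proof -
  have "(\<Sum>p\<in>mon_splits m. \<Sum>r\<in>mon_splits (fst p). h (fst r) (snd r) (snd p)) =
    (\<Sum>(p, r)\<in>Sigma (mon_splits m) (\<lambda>p. mon_splits (fst p)). h (fst r) (snd r) (snd p))"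
    by (rule sum.Sigma) simp_all
  also have "\<dots> = (\<Sum>(p, r)\<in>Sigma (mon_splits m) (\<lambda>p. mon_splits (snd p)). h (fst p) (fst r) (snd r))"
    by (rule sum.reindex_bij_witness[of _ "\<lambda>(p, r). ((fst p + fst r, snd r), (fst p, fst r))"
          "\<lambda>(p, r). ((fst r, snd r + snd p), (snd r, snd p))"])
      (auto simp: mon_splits_def add.assoc)
  also have "\<dots> = (\<Sum>p\<in>mon_splits m. \<Sum>r\<in>mon_splits (snd p). h (fst p) (fst r) (snd r))"
    by (rule sum.Sigma[symmetric]) simp_all
  finally show ?thesis .
qed

instantiation mps :: (type) comm_ring_1
begin

definition "0 = Abs_mps (\<lambda>m. 0)"
definition "1 = Abs_mps (\<lambda>m. if m = 0 then 1 else 0)"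
definition "f + g = Abs_mps (\<lambda>m. mps_nth f m + mps_nth g m)"
definition "f - g = Abs_mps (\<lambda>m. mps_nth f m - mps_nth g m)"
definition "- f = Abs_mps (\<lambda>m. - mps_nth f m)"
definition "f * g = Abs_mps (\<lambda>m. \<Sum>p\<in>mon_splits m. mps_nth f (fst p) * mps_nth g (snd p))"

instance
proof
  fix f g h :: "'a mps"
  have nth_mult: "mps_nth (f * g) m = (\<Sum>p\<in>mon_splits m. mps_nth f (fst p) * mps_nth g (snd p))"
    for f g :: "'a mps" and m
    unfolding times_mps_def mps_nth_Abs ..
  have nth_add: "mps_nth (f + g) m = mps_nth f m + mps_nth g m" for f g :: "'a mps" and m
    unfolding plus_mps_def mps_nth_Abs ..
  have nth_diff: "mps_nth (f - g) m = mps_nth f m - mps_nth g m" for f g :: "'a mps" and m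
    unfolding minus_mps_def mps_nth_Abs ..
  have nth_uminus: "mps_nth (- f) m = - mps_nth f m" for f :: "'a mps" and m
    unfolding uminus_mps_def mps_nth_Abs ..
  have nth_zero: "mps_nth (0 :: 'a mps) m = 0" for m
    unfolding zero_mps_def mps_nth_Abs ..
  have nth_one: "mps_nth (1 :: 'a mps) m = (if m = 0 then 1 else 0)" for m
    unfolding one_mps_def mps_nth_Abs ..
  show "f * g * h = f * (g * h)"
  proof (rule mps_eqI)
    fix m
    show "mps_nth (f * g * h) m = mps_nth (f * (g * h)) m"
      unfolding nth_mult sum_distrib_left sum_distrib_right mult.assoc
      by (rule sum_mon_splits_assoc)
  qed
  show "f * g = g * f"
  proof (rule mps_eqI)
    fix m
    show "mps_nth (f * g) m = mps_nth (g * f) m"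
      unfolding nth_mult
      by (subst sum_mon_splits_swap) (rule sum.cong[OF refl mult.commute])
  qed
  show "1 * f = f"
  proof (rule mps_eqI)
    fix m
    have "mps_nth (1 * f) m = (\<Sum>p\<in>{(0, m)}. mps_nth 1 (fst p) * mps_nth f (snd p))"
      unfolding nth_mult
      by (rule sum.mono_neutral_right[OF finite_mon_splits]) (auto simp: mon_splits_def nth_one)
    then show "mps_nth (1 * f) m = mps_nth f m"
      by (simp add: nth_one)
  qed
  show "(f + g) * h = f * h + g * h"
    by (rule mps_eqI) (simp only: nth_mult nth_add distrib_right sum.distrib)
  show "(0 :: 'a mps) \<noteq> 1"
  proof
    assume "(0 :: 'a mps) = 1"
    then have "mps_nth (0 :: 'a mps) 0 = mps_nth 1 0" by (rule arg_cong)
    then show False by (simp add: nth_zero nth_one)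
  qed
  show "f + g + h = f + (g + h)" "f + g = g + f" "0 + f = f" "- f + f = 0" "f - g = f + - g"
    by (rule mps_eqI, simp only: nth_add nth_diff nth_uminus nth_zero; simp)+
qed

end

definition mps_var :: "'v \<Rightarrow> 'v mps" where
  "mps_var v = Abs_mps (\<lambda>m. if m = Poly_Mapping.single v 1 then 1 else 0)"

text \<open>Limit in the coefficientwise (product of discrete) topology; convergence of an
  integer sequence means that it is eventually constant.\<close>

definition mps_lim :: "(nat \<Rightarrow> 'v mps) \<Rightarrow> 'v mps" where
  "mps_lim F = Abs_mps (\<lambda>m. lim (\<lambda>N. mps_nth (F N) m))"

datatype 'g free_monoid = FM (letters: "'g list")

instantiation free_monoid :: (type) monoid_add
begin

definition "0 = FM []"
definition "a + b = FM (letters a @ letters b)"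

instance
  by standard (simp_all add: zero_free_monoid_def plus_free_monoid_def)

end

type_synonym ('g, 'r) free_algebra = "'g free_monoid \<Rightarrow>\<^sub>0 'r"

definition fa_word :: "'g list \<Rightarrow> ('g, 'r::comm_ring_1) free_algebra" where
  "fa_word g = Poly_Mapping.single (FM g) 1"

definition fa_scalar :: "'r::comm_ring_1 \<Rightarrow> ('g, 'r) free_algebra" where
  "fa_scalar c = Poly_Mapping.single 0 c"

definition fa_carrier :: "'g set \<Rightarrow> ('g, 'r::comm_ring_1) free_algebra set" where
  "fa_carrier B = {\<xi>. \<forall>g \<in> Poly_Mapping.keys \<xi>. set (letters g) \<subseteq> B}"

inductive_set ideal_gen :: "'a::ring_1 set \<Rightarrow> 'a set \<Rightarrow> 'a set"
  for R and S where
  zero: "0 \<in> ideal_gen R S"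
| gen: "s \<in> S \<Longrightarrow> s \<in> ideal_gen R S"
| add: "a \<in> ideal_gen R S \<Longrightarrow> b \<in> ideal_gen R S \<Longrightarrow> a + b \<in> ideal_gen R S"
| left: "r \<in> R \<Longrightarrow> a \<in> ideal_gen R S \<Longrightarrow> r * a \<in> ideal_gen R S"
| right: "r \<in> R \<Longrightarrow> a \<in> ideal_gen R S \<Longrightarrow> a * r \<in> ideal_gen R S"

text \<open>The ordered set \<open>\<box> < 1 < 2 < \<dots>\<close> is rendered as \<^typ>\<open>nat\<close>, with \<open>0\<close> for \<open>\<box>\<close>.
  A signed permutation is an odd function on the integers.\<close>

definition WD :: "nat \<Rightarrow> (int \<Rightarrow> int) set" where
  "WD n = {w. w permutes {- int n..int n} \<and> (\<forall>i. w (- i) = - w i) \<and>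
              even (card {i \<in> {1..int n}. w i < 0})}"

definition WD_inf :: "(int \<Rightarrow> int) set" where
  "WD_inf = (\<Union>n. WD n)"

definition S_inf :: "(int \<Rightarrow> int) set" where
  "S_inf = {w \<in> WD_inf. \<forall>i>0. w i > 0}"

definition sgen :: "nat \<Rightarrow> int \<Rightarrow> int" where
  "sgen i = (if i = 0 then transpose 1 (- 2) \<circ> transpose (- 1) 2
             else transpose (int i) (int i + 1) \<circ> transpose (- int i) (- int i - 1))"

definition word_perm :: "nat list \<Rightarrow> int \<Rightarrow> int" where
  "word_perm as = foldr (\<lambda>i w. sgen i \<circ> w) as id"

definition len :: "(int \<Rightarrow> int) \<Rightarrow> nat" where
  "len w = (LEAST k. \<exists>as. length as = k \<and> word_perm as = w)"

definition reduced_word :: "nat list \<Rightarrow> (int \<Rightarrow> int) \<Rightarrow> bool" where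
  "reduced_word as w \<longleftrightarrow> word_perm as = w \<and> length as = len w"

definition descent :: "(int \<Rightarrow> int) \<Rightarrow> nat \<Rightarrow> bool" where
  "descent w r \<longleftrightarrow> len (w \<circ> sgen r) < len w"

definition reduced_factorization :: "(int \<Rightarrow> int) list \<Rightarrow> (int \<Rightarrow> int) \<Rightarrow> bool" where
  "reduced_factorization us w \<longleftrightarrow>
     set us \<subseteq> WD_inf \<and> foldr (\<circ>) us id = w \<and> sum_list (map len us) = len w"

definition nc_relations :: "nat \<Rightarrow> (nat, 'r::comm_ring_1) free_algebra set" where
  "nc_relations n =
     {fa_word [i, i] |i. i < n} \<union>
     {fa_word [0, 1] - fa_word [1, 0]} \<union>
     {r. r = fa_word [0, 2, 0] - fa_word [2, 0, 2] \<and> 2 < n} \<union>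
     {fa_word [i, i + 1, i] - fa_word [i + 1, i, i + 1] |i. 0 < i \<and> i + 1 < n} \<union>
     {fa_word [i, j] - fa_word [j, i] |i j.
        i < n \<and> j < n \<and> i \<noteq> j \<and> {i, j} \<noteq> {0, 2} \<and> \<not> (0 < i \<and> j = i + 1) \<and> \<not> (0 < j \<and> i = j + 1)}"

text \<open>The nilCoxeter algebra of \<open>WD n\<close>, for \<open>n \<ge> 2\<close>, is the quotient of
  \<open>fa_carrier {..<n}\<close> by this ideal.  Its elements are handled through representatives.\<close>

definition nc_ideal :: "nat \<Rightarrow> (nat, 'r::comm_ring_1) free_algebra set" where
  "nc_ideal n = ideal_gen (fa_carrier {..<n}) (nc_relations n)"

definition nc_basis :: "nat \<Rightarrow> (int \<Rightarrow> int) \<Rightarrow> (nat, 'r::comm_ring_1) free_algebra" where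
  "nc_basis n w = fa_word (SOME as. set as \<subseteq> {..<n} \<and> reduced_word as w)"

text \<open>The coefficient of \<open>u\<^sub>w\<close> in the class of \<open>\<xi>\<close>.  The classes of the \<open>nc_basis n v\<close>,
  \<open>v \<in> WD n\<close>, form a basis of the quotient, so the family \<open>c\<close> exists and is unique on
  \<open>fa_carrier {..<n}\<close>.\<close>

definition nc_coeff ::
    "nat \<Rightarrow> (nat, 'r::comm_ring_1) free_algebra \<Rightarrow> (int \<Rightarrow> int) \<Rightarrow> 'r" where
  "nc_coeff n \<xi> w =
     (THE c. (\<forall>v. v \<notin> WD n \<longrightarrow> c v = 0) \<and>
             \<xi> - (\<Sum>v\<in>WD n. fa_scalar (c v) * nc_basis n v) \<in> nc_ideal n) w"

definition nc_fac :: "'r::comm_ring_1 \<Rightarrow> nat \<Rightarrow> (nat, 'r) free_algebra" where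
  "nc_fac t i = 1 + fa_scalar t * fa_word [i]"

text \<open>\<open>At_ser\<close> is the series with a tilde.\<close>

definition A_ser :: "nat \<Rightarrow> nat \<Rightarrow> 'r::comm_ring_1 \<Rightarrow> (nat, 'r) free_algebra" where
  "A_ser n i t = prod_list (map (nc_fac t) (rev [i..<n]))"

definition At_ser :: "nat \<Rightarrow> nat \<Rightarrow> 'r::comm_ring_1 \<Rightarrow> (nat, 'r) free_algebra" where
  "At_ser n i t = prod_list (map (nc_fac (- t)) [i..<n])"

definition D_ser :: "nat \<Rightarrow> 'r::comm_ring_1 \<Rightarrow> (nat, 'r) free_algebra" where
  "D_ser n t = prod_list (map (nc_fac t) (rev [2..<n] @ [1, 0] @ [2..<n]))"

text \<open>Each function is defined from the nilCoxeter algebra of \<open>WD n\<close> for the least \<open>n \<ge> 2\<close>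
  with \<open>w \<in> WD n\<close> (larger \<open>n\<close> give the same result).  The presentation makes sense only for
  \<open>n \<ge> 2\<close>, since \<open>sgen 0\<close> moves \<open>2\<close>.\<close>

definition rank :: "(int \<Rightarrow> int) \<Rightarrow> nat" where
  "rank w = (LEAST n. 2 \<le> n \<and> w \<in> WD n)"

text \<open>Families of variables are sequences \<open>x 1, x 2, \<dots>\<close> in a power series ring (the value at
  \<open>0\<close> is not used); a finite set of variables is padded with zeros.  Infinite products are
  limits of their partial products.\<close>

definition ser_prod ::
    "(('v mps) \<Rightarrow> (nat, 'v mps) free_algebra) \<Rightarrow> (nat \<Rightarrow> 'v mps) \<Rightarrow> nat
      \<Rightarrow> (nat, 'v mps) free_algebra" where
  "ser_prod f t N = prod_list (map (\<lambda>k. f (t k)) [1..<N + 1])"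

definition schubert_D ::
    "(int \<Rightarrow> int) \<Rightarrow> (nat \<Rightarrow> 'v mps) \<Rightarrow> (nat \<Rightarrow> 'v mps) \<Rightarrow> (nat \<Rightarrow> 'v mps) \<Rightarrow> 'v mps" where
  "schubert_D w x y z = (let n = rank w in
     mps_lim (\<lambda>N. nc_coeff n
       (prod_list (map (\<lambda>i. At_ser n i (z i)) (rev [1..<n]))
        * ser_prod (D_ser n) x N
        * prod_list (map (\<lambda>i. A_ser n i (y i)) [1..<n])) w))"

definition stanley_G :: "(int \<Rightarrow> int) \<Rightarrow> (nat \<Rightarrow> 'v mps) \<Rightarrow> 'v mps" where
  "stanley_G w y = (let n = rank w in
     mps_lim (\<lambda>N. nc_coeff n (ser_prod (A_ser n 1) y N) w))"

definition double_stanley_G ::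
    "(int \<Rightarrow> int) \<Rightarrow> (nat \<Rightarrow> 'v mps) \<Rightarrow> (nat \<Rightarrow> 'v mps) \<Rightarrow> 'v mps" where
  "double_stanley_G w y z = (let n = rank w in
     mps_lim (\<lambda>N. nc_coeff n (ser_prod (At_ser n 1) z N * ser_prod (A_ser n 1) y N) w))"

definition mixed_stanley_I ::
    "(int \<Rightarrow> int) \<Rightarrow> (nat \<Rightarrow> 'v mps) \<Rightarrow> (nat \<Rightarrow> 'v mps) \<Rightarrow> (nat \<Rightarrow> 'v mps) \<Rightarrow> 'v mps" where
  "mixed_stanley_I w x y z = (let n = rank w in
     mps_lim (\<lambda>N. nc_coeff n
       (ser_prod (At_ser n 1) z N * ser_prod (D_ser n) x N * ser_prod (A_ser n 1) y N) w))"

datatype var = VX nat | VY nat | VZ nat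

abbreviation var_X :: "nat \<Rightarrow> var mps" where "var_X i \<equiv> mps_var (VX i)"
abbreviation var_Y :: "nat \<Rightarrow> var mps" where "var_Y i \<equiv> mps_var (VY i)"
abbreviation var_Z :: "nat \<Rightarrow> var mps" where "var_Z i \<equiv> mps_var (VZ i)"

text \<open>The sequences \<open>a\<^sub>1 < \<dots> < a\<^sub>p\<close> and \<open>b\<^sub>1 < \<dots> < b\<^sub>q\<close> are the values of \<open>a\<close> on
  \<open>{1..p}\<close> and of \<open>b\<close> on \<open>{1..q}\<close>.\<close>

definition compatible :: "(int \<Rightarrow> int) \<Rightarrow> (nat \<Rightarrow> nat) \<Rightarrow> nat \<Rightarrow> bool" where
  "compatible w a p \<longleftrightarrow> (\<forall>r. descent w r \<longrightarrow> r \<in> a ` {1..p})"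

text \<open>The factor \<open>u\<^sub>j\<close> is \<open>us ! (j - 1)\<close>.\<close>

definition factor :: "'a list \<Rightarrow> nat \<Rightarrow> 'a" where
  "factor us j = us ! (j - 1)"

definition compatible_factorizations ::
    "(int \<Rightarrow> int) \<Rightarrow> (nat \<Rightarrow> nat) \<Rightarrow> nat \<Rightarrow> (nat \<Rightarrow> nat) \<Rightarrow> nat \<Rightarrow> (int \<Rightarrow> int) list set" where
  "compatible_factorizations w a p b q =
     {us. length us = p + q - 1 \<and> reduced_factorization us w \<and>
        (\<forall>j\<in>{1..p + q - 1}. j \<noteq> q \<longrightarrow> factor us j \<in> S_inf) \<and>
        (\<forall>j\<in>{1..p + q - 1}. \<forall>i.
           (j < q \<and> 1 \<le> i \<and> i \<le> b (q - j) \<longrightarrow> factor us j (int i) = int i) \<and>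
           (j > q \<and> 1 \<le> i \<and> i \<le> a (j - q) \<longrightarrow> factor us j (int i) = int i))}"

text \<open>The set of all \<open>v k\<close> with \<open>c (i - 1) < k \<le> c i\<close>, where \<open>c 0\<close> is read as \<open>0\<close>, as a sequence padded with zeros.\<close>

definition block :: "(nat \<Rightarrow> 'v mps) \<Rightarrow> (nat \<Rightarrow> nat) \<Rightarrow> nat \<Rightarrow> nat \<Rightarrow> 'v mps" where
  "block v c i = (let l = (if i = 1 then 0 else c (i - 1)) in
     (\<lambda>k. if l + k \<le> c i then v (l + k) else 0))"

end

theory Submission
  imports Defs
begin

text \<open>
  The formula comes from multiplying out the defining product of the Schubert polynomial in the nilCoxeter
  algebra.  If this product is cut into \<open>p + q - 1\<close> consecutive pieces, the coefficient of \<open>u\<^sub>w\<close> is the sum,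
  over all reduced factorizations of \<open>w\<close> into \<open>p + q - 1\<close> elements, of the products of the coefficients in the
  pieces (\<open>factor_coeff_append\<close>, \<open>factor_coeff_concat\<close>).  The pieces are the blocks of the variables \<open>z\<close> and \<open>y\<close>
  given by \<open>b\<close> and \<open>a\<close>; the middle piece consists of \<open>D(X)\<close> and the first block on either side.

  It remains to see that the pieces may be replaced by those that define Stanley functions.  In the Schubert
  polynomial the variable \<open>y\<^sub>i\<close> comes with a series \<open>A\<^sub>i\<close> that starts at the letter \<open>i\<close>, whereas in a product of
  Stanley functions all variables of a block \<open>l < i \<le> e\<close> come with the same series \<open>A\<^sub>l\<^sub>+\<^sub>1\<close>.  The two
  differ by factors \<open>1 + y\<^sub>i u\<^sub>k\<close> with \<open>l < k < i\<close>.  These commute with all series further to the right, and at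
  the right end they do not change the coefficient of \<open>u\<^sub>w\<close>, since compatibility says that \<open>k\<close> is not a
  descent of \<open>w\<close> (\<open>replace_rows_right\<close>, \<open>factor_coeff_right_blocks\<close>).  Reversal of words gives the same on the
  left with \<open>w\<close> replaced by its inverse (\<open>factor_coeff_left_blocks\<close>); there the order of the variables within a
  block has to be reversed, which is possible because the series commute, by the Yang-Baxter relation
  (\<open>factor_equiv_rows\<close>).  After the replacement, an outer piece with start \<open>l\<close> only involves
  letters above \<open>l\<close>.  Its coefficients are therefore zero at elements outside the parabolic subgroup \<open>fixes_upto l\<close>, which
  leaves exactly the compatible factorizations, and are values of Stanley functions at elements inside
  (\<open>stanley_G_eq_factor_coeff\<close>, \<open>double_stanley_G_eq_factor_coeff\<close>).  The series \<open>D(X)\<close> is an infinite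
  product; its limit is taken at the end, monomial by monomial.

  Before this, coefficients have to be made computable.  The number of inversions gives the length function,
  splitting off two descents at a time gives the theorem of Matsumoto and Tits for the words in the
  generators, and as a consequence the coefficient of \<open>u\<^sub>w\<close> in a product of factors \<open>1 + t u\<^sub>k\<close> is a sum
  over the subwords that are reduced words of \<open>w\<close> (\<open>nc_coeff_factor_prod\<close>).\<close>

section \<open>Signed permutations, inversions and reduced words\<close>

text \<open>The generator \<open>sgen k\<close> is the reflection that exchanges two integers \<open>lo k < hi k\<close> and, at the same
  time, their negatives.  With \<open>lo 0 = - 1\<close> and \<open>hi 0 = 2\<close> the special generator has the same shape as
  the others, so that inversions and reduced words can be treated uniformly.  Two distinct generators \<open>i\<close>, \<open>j\<close> satisfy the
  braid relation of length three if \<open>hi i = lo j\<close> or \<open>hi j = lo i\<close>, and commute otherwise.\<close>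

definition lo :: "nat \<Rightarrow> int" where "lo k = (if k = 0 then - 1 else int k)"
definition hi :: "nat \<Rightarrow> int" where "hi k = (if k = 0 then 2 else int k + 1)"

lemma lo_hi: "lo k < hi k" "hi k > 0" "lo k \<noteq> 0" "lo k \<noteq> - hi k"
  by (auto simp: lo_def hi_def)

lemma sgen_apply:
  "sgen k x = (if x = lo k then hi k else if x = hi k then lo k
     else if x = - lo k then - hi k else if x = - hi k then - lo k else x)"
  by (auto simp: sgen_def lo_def hi_def transpose_def)

lemma sgen_sgen [simp]: "sgen k (sgen k x) = x"
  using lo_hi[of k] by (auto simp: sgen_apply)

lemma sgen_comp_sgen [simp]: "sgen k \<circ> sgen k = id" "w \<circ> sgen k \<circ> sgen k = w"
  by (auto simp: fun_eq_iff)

lemma sgen_minus: "sgen k (- x) = - sgen k x"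
  using lo_hi[of k] by (auto simp: sgen_apply)

lemma sgen_lo_hi [simp]: "sgen k (lo k) = hi k" "sgen k (hi k) = lo k"
  using lo_hi[of k] by (auto simp: sgen_apply)

lemma sgen_permutes:
  assumes "k < n" "2 \<le> n"
  shows "sgen k permutes {- int n..int n}"
  unfolding permutes_def
proof (intro conjI allI impI)
  show "sgen k x = x" if "x \<notin> {- int n..int n}" for x
    using that assms by (auto simp: sgen_apply lo_def hi_def)
  show "\<exists>!x. sgen k x = y" for y
    by (metis sgen_sgen)
qed

lemma WD_minus: "w \<in> WD n \<Longrightarrow> w (- i) = - w i"
  by (simp add: WD_def)

lemma WD_inj: "w \<in> WD n \<Longrightarrow> w i = w j \<longleftrightarrow> i = j"
  by (auto simp: WD_def dest!: permutes_inj dest: injD)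

lemma WD_zero [simp]: "w \<in> WD n \<Longrightarrow> w 0 = 0"
  using WD_minus[of w n 0] by simp

lemma WD_bounds: "w \<in> WD n \<Longrightarrow> \<bar>i\<bar> \<le> int n \<Longrightarrow> \<bar>w i\<bar> \<le> int n"
  using permutes_in_image[of w "{- int n..int n}" i] by (auto simp: WD_def)

lemma WD_outside: "w \<in> WD n \<Longrightarrow> \<bar>i\<bar> > int n \<Longrightarrow> w i = i"
  by (rule permutes_not_in[of w "{- int n..int n}"]) (auto simp: WD_def)

lemma id_in_WD [simp]: "id \<in> WD n"
proof -
  have "{i \<in> {1..int n}. id i < 0} = {}" by auto
  then have "even (card {i \<in> {1..int n}. id i < 0})" by (simp only: card.empty even_zero)
  then show ?thesis unfolding WD_def by (simp add: permutes_id del: id_apply) simp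
qed

lemma finite_WD: "finite (WD n)"
  by (rule finite_subset[OF _ finite_permutations[of "{- int n..int n}"]]) (auto simp: WD_def)

lemma WD_mono:
  assumes "n \<le> m"
  shows "WD n \<subseteq> WD m"
proof
  fix w assume w: "w \<in> WD n"
  have "{i \<in> {1..int m}. w i < 0} = {i \<in> {1..int n}. w i < 0}"
  proof (intro equalityI subsetI)
    fix i assume i: "i \<in> {i \<in> {1..int m}. w i < 0}"
    then have "\<not> int n < \<bar>i\<bar>" using WD_outside[OF w, of i] by auto
    then show "i \<in> {i \<in> {1..int n}. w i < 0}" using i by auto
  qed (use assms in auto)
  moreover have "w permutes {- int m..int m}"
    using w assms by (auto simp: WD_def intro: permutes_subset)
  ultimately show "w \<in> WD m" using w by (auto simp: WD_def)
qed

text \<open>For \<open>k > 0\<close> the positions of the negative entries are permuted; for \<open>k = 0\<close> the first two entries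
  change their signs, so the number of negative entries changes by \<open>-2\<close>, \<open>0\<close> or \<open>2\<close>.\<close>

lemma WD_comp_sgen:
  assumes w: "w \<in> WD n" and k: "k < n" and n: "2 \<le> n"
  shows "w \<circ> sgen k \<in> WD n"
proof -
  have "w permutes {- int n..int n}" using w by (simp add: WD_def)
  with sgen_permutes[OF k n] have p: "w \<circ> sgen k permutes {- int n..int n}"
    by (rule permutes_compose)
  have o: "(w \<circ> sgen k) (- i) = - (w \<circ> sgen k) i" for i
    by (simp add: sgen_minus WD_minus[OF w])
  let ?N = "\<lambda>v. {i \<in> {1..int n}. v i < (0::int)}"
  have ev: "even (card (?N w))" using w by (simp add: WD_def)
  have "even (card (?N (w \<circ> sgen k)))"
  proof (cases "k = 0")
    case False
    have "?N (w \<circ> sgen k) = sgen k ` ?N w"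
    proof (intro equalityI subsetI)
      fix i assume i: "i \<in> ?N (w \<circ> sgen k)"
      then have "sgen k i \<in> ?N w" using False k by (simp add: sgen_apply lo_def hi_def split: if_splits)
      then show "i \<in> sgen k ` ?N w" by (metis image_eqI sgen_sgen)
    next
      fix i assume "i \<in> sgen k ` ?N w"
      then show "i \<in> ?N (w \<circ> sgen k)" using False k
        by (auto simp: sgen_apply lo_def hi_def)
    qed
    then have "card (?N (w \<circ> sgen k)) = card (?N w)"
      by (simp add: card_image inj_on_def) (metis (no_types, lifting) card_image inj_onI sgen_sgen)
    then show ?thesis using ev by simp
  next
    case True
    define R where "R = {i \<in> {3..int n}. w i < 0}"
    have fR: "finite R" unfolding R_def by (rule finite_subset[of _ "{3..int n}"]) auto
    have split: "{1..int n} = {1, 2} \<union> {3..int n}" using n by auto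
    have m: "w (- 1) = - w 1" "w (- 2) = - w 2" by (rule WD_minus[OF w])+
    have s: "(w \<circ> sgen k) i = (if i = 1 then - w 2 else if i = 2 then - w 1 else w i)"
      if "i > 0" for i
    proof -
      have "sgen 0 1 = - 2" "sgen 0 2 = - 1" "i \<noteq> 1 \<Longrightarrow> i \<noteq> 2 \<Longrightarrow> sgen 0 i = i"
        using that by (simp_all add: sgen_apply lo_def hi_def)
      then show ?thesis using True m by (cases "i = 1"; cases "i = 2") simp_all
    qed
    have e1: "?N w = ({1} \<inter> {i. w i < 0}) \<union> ({2} \<inter> {i. w i < 0}) \<union> R"
      unfolding split R_def by auto
    have e2: "?N (w \<circ> sgen k) = ({1} \<inter> {i. w 2 > 0}) \<union> ({2} \<inter> {i. w 1 > 0}) \<union> R"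
      unfolding split R_def by (auto simp: s simp del: comp_apply)
    have "w 1 \<noteq> 0" "w 2 \<noteq> 0" using WD_inj[OF w, of _ 0] WD_zero[OF w] by auto
    moreover have "1 \<notin> R" "2 \<notin> R" by (auto simp: R_def)
    ultimately show ?thesis using ev fR unfolding e1 e2
      by (cases "w 1 < 0"; cases "w 2 < 0") (auto simp: not_less)
  qed
  with p o show ?thesis by (simp add: WD_def)
qed

lemma word_perm_append [simp]: "word_perm (as @ bs) = word_perm as \<circ> word_perm bs"
  unfolding word_perm_def by (induction as) (auto simp: o_assoc)

lemma word_perm_Nil [simp]: "word_perm [] = id"
  and word_perm_Cons: "word_perm (k # as) = sgen k \<circ> word_perm as"
  by (simp_all add: word_perm_def)

lemma word_perm_single [simp]: "word_perm [k] = sgen k"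
  by (simp add: word_perm_Cons)

lemma word_perm_in_WD:
  assumes "set as \<subseteq> {..<n}" "2 \<le> n"
  shows "word_perm as \<in> WD n"
  using assms(1)
proof (induction as rule: rev_induct)
  case (snoc k as)
  then show ?case using WD_comp_sgen[of "word_perm as" n k] assms(2)
    unfolding word_perm_append word_perm_single by (simp add: o_def)
qed simp

lemma WD_infE:
  assumes "w \<in> WD_inf"
  obtains n where "2 \<le> n" "w \<in> WD n" "m \<le> n"
proof -
  obtain k where "w \<in> WD k" using assms by (auto simp: WD_inf_def)
  then have "w \<in> WD (max k (max m 2))" using WD_mono[of k "max k (max m 2)"] by auto
  then show ?thesis by (intro that[of "max k (max m 2)"]) auto
qed

lemma WD_inf_I: "w \<in> WD n \<Longrightarrow> w \<in> WD_inf"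
  by (auto simp: WD_inf_def)

lemma word_perm_in_WD_inf: "word_perm as \<in> WD_inf"
proof -
  have le: "k \<le> Max (insert 2 (set as))" if "k \<in> insert 2 (set as)" for k
    by (rule Max_ge) (use that in simp_all)
  have "set as \<subseteq> {..<Suc (Max (insert 2 (set as)))}"
    using le by (simp add: subset_iff less_Suc_eq_le del: Max_insert)
  moreover have "2 \<le> Suc (Max (insert 2 (set as)))"
    using le[OF insertI1] by (rule le_SucI)
  ultimately show ?thesis using word_perm_in_WD WD_inf_I by blast
qed

lemma WD_inf_comp_sgen: "w \<in> WD_inf \<Longrightarrow> w \<circ> sgen k \<in> WD_inf"
  by (erule WD_infE[where m = "Suc k"]) (meson WD_inf_I WD_comp_sgen Suc_le_lessD)

text \<open>A pair \<open>(i, j)\<close> with \<open>i < j\<close> and \<open>i \<noteq> - j\<close> stands for the positive root \<open>e\<^sub>j - e\<^sub>i\<close> of type D, where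
  \<open>e\<^sub>-\<^sub>i = - e\<^sub>i\<close>.  The pairs \<open>(i, j)\<close> and \<open>(- j, - i)\<close> give the same root, so every inverted root is
  counted twice; this symmetric form makes the action of a generator a plain relabelling.\<close>

definition inversions :: "(int \<Rightarrow> int) \<Rightarrow> (int \<times> int) set" where
  "inversions w = {(i, j). i < j \<and> i \<noteq> 0 \<and> j \<noteq> 0 \<and> i \<noteq> - j \<and> w j < w i}"

lemma finite_inversions:
  assumes "w \<in> WD_inf"
  shows "finite (inversions w)"
proof -
  obtain n where n: "w \<in> WD n" using assms by (rule WD_infE)
  have "\<bar>i\<bar> \<le> int n \<and> \<bar>j\<bar> \<le> int n" if "i < j" "w j < w i" for i j
    using that WD_outside[OF n, of i] WD_outside[OF n, of j] WD_bounds[OF n, of i] WD_bounds[OF n, of j]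
    by linarith
  then have "inversions w \<subseteq> {- int n..int n} \<times> {- int n..int n}"
    by (force simp: inversions_def)
  then show ?thesis by (rule finite_subset) simp
qed

text \<open>The reflection \<open>sgen k\<close> makes exactly one positive root negative, its own.\<close>

lemma sgen_less:
  assumes "i < j" "i \<noteq> 0" "j \<noteq> 0" "i \<noteq> - j" "(i, j) \<noteq> (lo k, hi k)" "(i, j) \<noteq> (- hi k, - lo k)"
  shows "sgen k i < sgen k j \<and> sgen k i \<noteq> 0 \<and> sgen k j \<noteq> 0 \<and> sgen k i \<noteq> - sgen k j"
proof (cases "k = 0")
  case True
  then show ?thesis using assms unfolding sgen_apply by (simp add: lo_def hi_def; intro conjI impI; auto)
next
  case False
  then show ?thesis using assms unfolding sgen_apply by (simp add: lo_def hi_def; intro conjI impI; auto)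
qed

text \<open>Relabelling by \<open>sgen k\<close> carries the inversions of \<open>w\<close> to those of \<open>w \<circ> sgen k\<close>, except for the two pairs
  that represent the root of \<open>sgen k\<close> itself.\<close>

lemma inversions_ascent:
  assumes w: "w \<in> WD_inf" and asc: "w (lo k) < w (hi k)"
  shows "card (inversions (w \<circ> sgen k)) = card (inversions w) + 2"
proof -
  have m: "w (- i) = - w i" for i using w by (auto simp: WD_inf_def WD_minus)
  let ?f = "\<lambda>(i, j). (sgen k i, sgen k j)"
  let ?P = "{(lo k, hi k), (- hi k, - lo k)}"
  have "inversions (w \<circ> sgen k) = ?f ` inversions w \<union> ?P"
  proof (intro equalityI subrelI)
    fix i j assume ij: "(i, j) \<in> inversions (w \<circ> sgen k)"
    show "(i, j) \<in> ?f ` inversions w \<union> ?P"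
    proof (cases "(i, j) \<in> ?P")
      case False
      with ij have "(sgen k i, sgen k j) \<in> inversions w"
      using sgen_less[of i j k] by (auto simp: inversions_def)
      then have "?f (sgen k i, sgen k j) \<in> ?f ` inversions w" by (rule imageI)
      then show ?thesis by simp
    next
      case True
      then show ?thesis by (rule UnI2)
    qed
  next
    fix i j assume "(i, j) \<in> ?f ` inversions w \<union> ?P"
    then consider (a) i' j' where "(i', j') \<in> inversions w" "i = sgen k i'" "j = sgen k j'"
      | (b) "(i, j) = (lo k, hi k)" | (c) "(i, j) = (- hi k, - lo k)" by auto
    then show "(i, j) \<in> inversions (w \<circ> sgen k)"
    proof cases
      case a
      have "(i', j') \<noteq> (lo k, hi k)" "(i', j') \<noteq> (- hi k, - lo k)"
        using a(1) asc by (auto simp: inversions_def m)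
      with a show ?thesis using sgen_less[of i' j' k] by (auto simp: inversions_def)
    next
      case b
      then show ?thesis using asc lo_hi[of k] by (auto simp: inversions_def)
    next
      case c
      then show ?thesis using asc lo_hi[of k] by (auto simp: inversions_def m sgen_minus)
    qed
  qed
  moreover have disj: "?f ` inversions w \<inter> ?P = {}"
  proof -
    have False if "(i, j) \<in> inversions w" "?f (i, j) \<in> ?P" for i j
    proof -
      have "?f (?f (i, j)) \<in> ?f ` ?P"
        using that(2) by (rule imageI)
      then have "\<not> i < j" using lo_hi(1)[of k] by (auto simp: sgen_minus)
      then show False using that(1) by (simp add: inversions_def)
    qed
    then have "x \<notin> ?P" if "x \<in> ?f ` inversions w" for x
      using that by auto
    then show ?thesis by blast
  qed
  moreover have "inj_on ?f (inversions w)"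
    by (rule inj_onI) (clarsimp, metis sgen_sgen)
  moreover have "card ?P = 2" using lo_hi[of k] by auto
  moreover have "card (?f ` inversions w \<union> ?P) = card (?f ` inversions w) + card ?P"
    using disj finite_inversions[OF w] by (intro card_Un_disjoint) auto
  ultimately show ?thesis by (simp only: card_image)
qed

lemma inversions_descent:
  assumes w: "w \<in> WD_inf" and desc: "w (hi k) < w (lo k)"
  shows "card (inversions (w \<circ> sgen k)) + 2 = card (inversions w)"
  using inversions_ascent[OF WD_inf_comp_sgen[OF w], of k k] desc by simp

lemma WD_ascent_or_descent:
  assumes "w \<in> WD_inf"
  shows "w (lo k) < w (hi k) \<or> w (hi k) < w (lo k)"
  using assms lo_hi(1)[of k] by (auto simp: WD_inf_def) (metis WD_inj linorder_neqE less_irrefl)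

text \<open>Without descents the values increase along \<open>1, \<dots>, n\<close> and \<open>- w 1 < w 2\<close>, so at most \<open>w 1\<close> can be
  negative; an even number of sign changes excludes that, and an increasing bijection of
  \<open>{1..n}\<close> is the identity.\<close>

lemma no_descent_imp_id:
  assumes w: "w \<in> WD n" and n: "2 \<le> n" and nd: "\<And>k. k < n \<Longrightarrow> \<not> w (hi k) < w (lo k)"
  shows "w = id"
proof -
  have asc: "w (lo k) < w (hi k)" if "k < n" for k
    using nd[OF that] WD_ascent_or_descent[OF WD_inf_I[OF w], of k] by blast
  have step: "w (int k) < w (int k + 1)" if "1 \<le> k" "k < n" for k
    using asc[of k] that by (simp add: lo_def hi_def)
  have zero: "- w 1 < w 2" using asc[of 0] n WD_minus[OF w] by (simp add: lo_def hi_def)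
  have pos2: "w (int k) > 0" if "2 \<le> k" "k \<le> n" for k
    using that
  proof (induction k rule: dec_induct)
    case base
    show ?case using zero step[of 1] n by simp
  next
    case (step k)
    then show ?case using \<open>\<And>k. 1 \<le> k \<Longrightarrow> k < n \<Longrightarrow> w (int k) < w (int k + 1)\<close>[of k]
      by (simp add: add.commute)
  qed
  have pos1: "w 1 > 0"
  proof (rule ccontr)
    assume "\<not> w 1 > 0"
    moreover have "w 1 \<noteq> 0" using WD_inj[OF w, of 1 0] w by simp
    ultimately have neg1: "w 1 < 0" by simp
    have "{i \<in> {1..int n}. w i < 0} = {1}"
    proof (intro equalityI subsetI)
      fix i assume i: "i \<in> {i \<in> {1..int n}. w i < 0}"
      then have "nat i \<le> n" "int (nat i) = i" by auto
      with i have "\<not> 2 \<le> nat i" using pos2[of "nat i"] by auto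
      then show "i \<in> {1}" using i by auto
    qed (use n neg1 in auto)
    then show False using w by (simp add: WD_def)
  qed
  have ge: "w (int k) \<ge> int k" if "1 \<le> k" "k \<le> n" for k
    using that
  proof (induction k rule: dec_induct)
    case base
    show ?case using pos1 by simp
  next
    case (step k)
    then show ?case using \<open>\<And>k. 1 \<le> k \<Longrightarrow> k < n \<Longrightarrow> w (int k) < w (int k + 1)\<close>[of k]
      by (simp add: add.commute)
  qed
  have le: "w (int k) \<le> int k" if "1 \<le> k" "k \<le> n" for k
    using that(2,1)
  proof (induction k rule: inc_induct)
    case base
    show ?case using WD_bounds[OF w, of "int n"] by simp
  next
    case (step k)
    then show ?case using \<open>\<And>k. 1 \<le> k \<Longrightarrow> k < n \<Longrightarrow> w (int k) < w (int k + 1)\<close>[of k]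
      by (simp add: add.commute)
  qed
  have eq: "w (int k) = int k" for k
    using ge[of k] le[of k] WD_outside[OF w, of "int k"] w by (cases "k = 0"; cases "k \<le> n") auto
  show ?thesis
  proof
    fix i show "w i = id i"
      using eq[of "nat i"] eq[of "nat (- i)"] WD_minus[OF w, of i] by (cases "i \<ge> 0") auto
  qed
qed

lemma card_inversions_word_perm: "card (inversions (word_perm as)) \<le> 2 * length as"
proof (induction as rule: rev_induct)
  case Nil
  have "inversions id = {}" by (auto simp: inversions_def)
  then show ?case unfolding word_perm_Nil by (simp add: id_def)
next
  case (snoc k as)
  show ?case using snoc WD_ascent_or_descent[OF word_perm_in_WD_inf, of as k]
      inversions_ascent[OF word_perm_in_WD_inf, of as k]
      inversions_descent[OF word_perm_in_WD_inf, of as k]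
    unfolding word_perm_append word_perm_single by (auto simp: o_def)
qed

text \<open>Sorting: multiplying with the generator of a descent removes two inversions, and this is repeated until no
  descent is left.\<close>

lemma short_word_exists:
  assumes "w \<in> WD n" and n: "2 \<le> n"
  shows "\<exists>as. set as \<subseteq> {..<n} \<and> word_perm as = w \<and> 2 * length as = card (inversions w)"
  using assms(1)
proof (induction "card (inversions w)" arbitrary: w rule: less_induct)
  case less
  show ?case
  proof (cases "\<exists>k<n. w (hi k) < w (lo k)")
    case False
    then have "w = id" using no_descent_imp_id[OF less.prems n] by blast
    moreover have "inversions id = {}" by (auto simp: inversions_def)
    ultimately show ?thesis by (intro exI[of _ "[]"]) simp
  next
    case True
    then obtain k where k: "k < n" "w (hi k) < w (lo k)" by blast
    have c: "card (inversions (w \<circ> sgen k)) + 2 = card (inversions w)"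
      using inversions_descent[OF WD_inf_I[OF less.prems] k(2)] .
    obtain as where as: "set as \<subseteq> {..<n}" "word_perm as = w \<circ> sgen k"
        "2 * length as = card (inversions (w \<circ> sgen k))"
      using less.hyps[of "w \<circ> sgen k"] c WD_comp_sgen[OF less.prems k(1) n] by auto
    then show ?thesis using k c by (intro exI[of _ "as @ [k]"]) (auto simp: word_perm_Cons comp_assoc)
  qed
qed

lemma len_le: "word_perm as = w \<Longrightarrow> len w \<le> length as"
  unfolding len_def by (rule Least_le) blast

lemma len_word_exists:
  assumes "word_perm as = w"
  shows "\<exists>bs. word_perm bs = w \<and> length bs = len w"
  using LeastI[of "\<lambda>k. \<exists>as. length as = k \<and> word_perm as = w" "length as"] assms
  unfolding len_def by auto

text \<open>A generator changes the number of inversions by two, so no word can be shorter than half of them, and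
  sorting produces a word that attains this bound.  Since the sorting word of an element of
  \<open>WD n\<close> only uses letters below \<open>n\<close>, the length does not depend on the ambient group.\<close>

lemma two_len:
  assumes "w \<in> WD_inf"
  shows "2 * len w = card (inversions w)"
proof -
  obtain n where n: "2 \<le> n" "w \<in> WD n" using assms by (rule WD_infE)
  then obtain as where as: "word_perm as = w" "2 * length as = card (inversions w)"
    using short_word_exists by blast
  moreover obtain bs where "word_perm bs = w" "length bs = len w"
    using len_word_exists[OF as(1)] by blast
  ultimately show ?thesis
    using len_le[OF as(1)] card_inversions_word_perm[of bs] by simp
qed

lemma reduced_word_exists:
  assumes "w \<in> WD n" "2 \<le> n"
  obtains as where "set as \<subseteq> {..<n}" "reduced_word as w"
  using short_word_exists[OF assms] two_len[OF WD_inf_I[OF assms(1)]]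
  by (auto simp: reduced_word_def)

lemma descent_iff:
  assumes "w \<in> WD_inf"
  shows "descent w k \<longleftrightarrow> w (hi k) < w (lo k)"
  using WD_ascent_or_descent[OF assms, of k] inversions_ascent[OF assms, of k]
    inversions_descent[OF assms, of k] two_len[OF assms] two_len[OF WD_inf_comp_sgen[OF assms, of k]]
  by (auto simp: descent_def)

lemma len_descent: "w \<in> WD_inf \<Longrightarrow> descent w k \<Longrightarrow> len w = Suc (len (w \<circ> sgen k))"
  using inversions_descent[of w k] two_len[of w] two_len[OF WD_inf_comp_sgen, of w k]
  by (simp add: descent_iff)

lemma reduced_word_snocD:
  assumes "reduced_word (as @ [k]) w"
  shows "descent w k" "reduced_word as (w \<circ> sgen k)"
proof -
  have w: "w = word_perm as \<circ> sgen k" and l: "Suc (length as) = len w"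
    using assms by (auto simp: reduced_word_def word_perm_Cons)
  then have as: "word_perm as = w \<circ> sgen k" by simp
  show d: "descent w k" using len_le[OF as] l by (simp add: descent_def)
  have "w \<in> WD_inf" unfolding w by (intro WD_inf_comp_sgen word_perm_in_WD_inf)
  then show "reduced_word as (w \<circ> sgen k)"
    using as l len_descent[OF _ d] by (simp add: reduced_word_def)
qed

lemma reduced_word_snocI:
  assumes "w \<in> WD_inf" "descent w k" "reduced_word as (w \<circ> sgen k)"
  shows "reduced_word (as @ [k]) w"
  using assms len_descent[OF assms(1,2)] by (auto simp: reduced_word_def word_perm_Cons)

text \<open>The last letter of a reduced word is a descent, and an element of \<open>WD n\<close> has no descent at \<open>n\<close> or
  beyond.  This is what makes all coefficients below independent of the rank.\<close>

lemma reduced_word_letters_less: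
  assumes "w \<in> WD n" "2 \<le> n" "reduced_word as w"
  shows "set as \<subseteq> {..<n}"
  using assms(1,3)
proof (induction as arbitrary: w rule: rev_induct)
  case (snoc k as)
  have d: "w (hi k) < w (lo k)"
    using reduced_word_snocD(1)[OF snoc.prems(2)] descent_iff[OF WD_inf_I[OF snoc.prems(1)]] by blast
  have "k < n"
  proof (rule ccontr)
    assume "\<not> k < n"
    then have "w (int k + 1) < w (int k)" "int n \<le> int k" using d \<open>2 \<le> n\<close>
      by (auto simp: lo_def hi_def split: if_splits)
    then show False
      using WD_outside[OF snoc.prems(1), of "int k + 1"] WD_outside[OF snoc.prems(1), of "int k"]
        WD_bounds[OF snoc.prems(1), of "int k"] by (cases "int k = int n") auto
  qed
  moreover have "set as \<subseteq> {..<n}"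
    using snoc.IH[OF WD_comp_sgen[OF snoc.prems(1) \<open>k < n\<close> assms(2)]] reduced_word_snocD(2)[OF snoc.prems(2)]
    by blast
  ultimately show ?case by simp
qed simp

text \<open>This is the parabolic subgroup generated by the \<open>sgen k\<close> with \<open>k > l\<close>; it is the set to which the
  outer factors of a compatible factorization are confined.\<close>

definition fixes_upto :: "nat \<Rightarrow> (int \<Rightarrow> int) set" where
  "fixes_upto l = {w \<in> S_inf. \<forall>i. 1 \<le> i \<and> i \<le> l \<longrightarrow> w (int i) = int i}"

lemma fixes_upto_comp_sgen:
  assumes w: "w \<in> fixes_upto l" and k: "l < k"
  shows "w \<circ> sgen k \<in> fixes_upto l"
  using assms WD_inf_comp_sgen[of w k]
  by (auto simp: fixes_upto_def S_inf_def sgen_apply lo_def hi_def)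

lemma word_perm_in_fixes_upto:
  assumes "set as \<subseteq> {l<..}"
  shows "word_perm as \<in> fixes_upto l"
  using assms
proof (induction as rule: rev_induct)
  case Nil
  show ?case unfolding word_perm_Nil using WD_inf_I[OF id_in_WD] by (simp add: fixes_upto_def S_inf_def id_def)
next
  case (snoc k as)
  then show ?case using fixes_upto_comp_sgen[of "word_perm as" l k]
    unfolding word_perm_append word_perm_single by (simp add: o_def)
qed

lemma reduced_word_letters_greater:
  assumes "w \<in> fixes_upto l" "reduced_word as w"
  shows "set as \<subseteq> {l<..}"
  using assms
proof (induction as arbitrary: w rule: rev_induct)
  case (snoc k as)
  have wi: "w \<in> WD_inf" and pos: "\<And>i. i > 0 \<Longrightarrow> w i > 0"
    and fx: "\<And>i. 1 \<le> i \<Longrightarrow> i \<le> l \<Longrightarrow> w (int i) = int i"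
    using snoc.prems(1) by (auto simp: fixes_upto_def S_inf_def)
  obtain n where n: "w \<in> WD n" using wi by (rule WD_infE)
  have d: "w (hi k) < w (lo k)"
    using reduced_word_snocD(1)[OF snoc.prems(2)] descent_iff[OF wi] by blast
  have "l < k"
  proof (rule ccontr)
    assume kl: "\<not> l < k"
    show False
    proof (cases "k = 0")
      case True
      then show False using d pos[of 1] pos[of 2] WD_minus[OF n, of 1] by (simp add: lo_def hi_def)
    next
      case False
      then have lt: "w (int k + 1) < int k" and wk: "w (int k) = int k"
        using d kl fx[of k] by (auto simp: lo_def hi_def)
      define j where "j = w (int k + 1)"
      have "j > 0" unfolding j_def using pos by simp
      then have "w j = j" using fx[of "nat j"] lt kl unfolding j_def[symmetric] by simp
      then have "j = int k + 1" using WD_inj[OF n, of j "int k + 1"] unfolding j_def[symmetric] by simp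
      then show False using lt unfolding j_def[symmetric] by simp
    qed
  qed
  moreover have "set as \<subseteq> {l<..}"
    using snoc.IH[OF fixes_upto_comp_sgen[OF snoc.prems(1) \<open>l < k\<close>]] reduced_word_snocD(2)[OF snoc.prems(2)]
    by blast
  ultimately show ?case by simp
qed simp


section \<open>Equivalence of reduced words and the coefficient functional\<close>

text \<open>A reflection that commutes with \<open>sgen j\<close> preserves its root up to sign, and being a generator other than
  \<open>sgen j\<close> it maps this positive root to a positive one.  The second alternative occurs for the
  commuting generators \<open>0\<close> and \<open>1\<close>, which act on the same entries.\<close>

lemma sgen_commute:
  assumes "i \<noteq> j" "hi i \<noteq> lo j" "hi j \<noteq> lo i"
  shows "sgen i (lo j) = lo j \<and> sgen i (hi j) = hi j \<or> sgen i (lo j) = - hi j \<and> sgen i (hi j) = - lo j"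
    and "sgen i \<circ> sgen j = sgen j \<circ> sgen i"
proof -
  show *: "sgen i (lo j) = lo j \<and> sgen i (hi j) = hi j \<or> sgen i (lo j) = - hi j \<and> sgen i (hi j) = - lo j"
    using assms by (cases "i = 0"; cases "j = 0") (auto simp: sgen_apply lo_def hi_def)
  show "sgen i \<circ> sgen j = sgen j \<circ> sgen i"
  proof
    fix x
    show "(sgen i \<circ> sgen j) x = (sgen j \<circ> sgen i) x"
    proof (cases "x = lo j \<or> x = hi j \<or> x = - lo j \<or> x = - hi j")
      case True
      then show ?thesis using * by (auto simp: sgen_minus)
    next
      case False
      then have x: "sgen j x = x" by (simp add: sgen_apply)
      have "sgen i x \<noteq> y" if "y \<in> {lo j, hi j, - lo j, - hi j}" for y
      proof
        assume "sgen i x = y"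
        then have "x = sgen i y" by auto
        then show False using * that False by (auto simp: sgen_minus)
      qed
      then have "sgen j (sgen i x) = sgen i x" by (simp add: sgen_apply)
      then show ?thesis using x by simp
    qed
  qed
qed

lemma sgen_braid_apply:
  assumes "hi i = lo j"
  shows "sgen i (hi j) = hi j" "sgen j (lo i) = lo i"
  using assms by (auto simp: sgen_apply lo_def hi_def split: if_splits)

lemma sgen_braid:
  assumes "hi i = lo j"
  shows "sgen i \<circ> sgen j \<circ> sgen i = sgen j \<circ> sgen i \<circ> sgen j"
proof
  fix x
  have *: "sgen i (hi j) = hi j" "sgen j (lo i) = lo i" "sgen i (lo j) = lo i" "sgen j (hi i) = hi j"
    using sgen_braid_apply[OF assms] assms by (metis sgen_lo_hi)+
  show "(sgen i \<circ> sgen j \<circ> sgen i) x = (sgen j \<circ> sgen i \<circ> sgen j) x"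
  proof (cases "x \<in> {lo i, lo j, hi j, - lo i, - lo j, - hi j}")
    case True
    then show ?thesis using * assms by (auto simp: sgen_minus)
  next
    case False
    then have "sgen i x = x" "sgen j x = x" using assms by (auto simp: sgen_apply)
    then show ?thesis by simp
  qed
qed

lemma reduced_word_cong:
  "word_perm as = word_perm bs \<Longrightarrow> length as = length bs \<Longrightarrow> reduced_word as w = reduced_word bs w"
  by (simp add: reduced_word_def)

text \<open>Two descents of \<open>w\<close> can be split off together: \<open>w\<close> has a reduced word that ends in the longest element of
  the subgroup generated by both, and this element may be written with either letter last.\<close>

lemma reduced_word_two_descents_commute:
  assumes w: "w \<in> WD n" and n: "2 \<le> n" and ij: "i < n" "j < n" "i \<noteq> j" "hi i \<noteq> lo j" "hi j \<noteq> lo i"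
    and d: "descent w i" "descent w j"
  obtains g where "set g \<subseteq> {..<n}" "reduced_word (g @ [j, i]) w" "reduced_word (g @ [i, j]) w"
proof -
  note wi = WD_inf_I[OF w]
  have w1: "w \<circ> sgen i \<in> WD n" and w2: "w \<circ> sgen i \<circ> sgen j \<in> WD n"
    using WD_comp_sgen w ij n by blast+
  have d1: "descent (w \<circ> sgen i) j"
    using d(2) sgen_commute(1)[OF ij(3-5)] descent_iff[OF wi] descent_iff[OF WD_inf_I[OF w1]]
      WD_minus[OF w, of "lo j"] WD_minus[OF w, of "hi j"] by auto
  obtain g where g: "set g \<subseteq> {..<n}" "reduced_word g (w \<circ> sgen i \<circ> sgen j)"
    using reduced_word_exists[OF w2 n] by blast
  then have "reduced_word ((g @ [j]) @ [i]) w"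
    using reduced_word_snocI[OF WD_inf_I[OF w1] d1] reduced_word_snocI[OF wi d(1)] by blast
  then have 1: "reduced_word (g @ [j, i]) w" by simp
  have "word_perm (g @ [j, i]) = word_perm (g @ [i, j])"
    using sgen_commute(2)[OF ij(3-5)] by (simp add: word_perm_Cons)
  then show ?thesis using that[OF g(1) 1] 1 reduced_word_cong[of "g @ [j, i]" "g @ [i, j]" w] by simp
qed

lemma reduced_word_two_descents_braid:
  assumes w: "w \<in> WD n" and n: "2 \<le> n" and ij: "i < n" "j < n" "hi i = lo j"
    and d: "descent w i" "descent w j"
  obtains g where "set g \<subseteq> {..<n}" "reduced_word (g @ [i, j, i]) w" "reduced_word (g @ [j, i, j]) w"
proof -
  note wi = WD_inf_I[OF w]
  have w1: "w \<circ> sgen i \<in> WD n" and w2: "w \<circ> sgen i \<circ> sgen j \<in> WD n"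
    and w3: "w \<circ> sgen i \<circ> sgen j \<circ> sgen i \<in> WD n"
    using WD_comp_sgen w ij n by blast+
  have dd: "w (hi i) < w (lo i)" "w (hi j) < w (hi i)"
    using d descent_iff[OF wi] ij(3) by auto
  have *: "sgen i (hi j) = hi j" "sgen j (lo i) = lo i" "sgen i (lo j) = lo i" "sgen j (hi i) = hi j"
    using sgen_braid_apply[OF ij(3)] ij(3) by (metis sgen_lo_hi)+
  have d1: "descent (w \<circ> sgen i) j"
    using descent_iff[OF WD_inf_I[OF w1]] dd * by auto
  have d2: "descent (w \<circ> sgen i \<circ> sgen j) i"
    using descent_iff[OF WD_inf_I[OF w2]] dd * by auto
  obtain g where g: "set g \<subseteq> {..<n}" "reduced_word g (w \<circ> sgen i \<circ> sgen j \<circ> sgen i)"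
    using reduced_word_exists[OF w3 n] by blast
  then have "reduced_word (((g @ [i]) @ [j]) @ [i]) w"
    using reduced_word_snocI[OF WD_inf_I[OF w1] d1] reduced_word_snocI[OF WD_inf_I[OF w2] d2]
      reduced_word_snocI[OF wi d(1)] by blast
  then have 1: "reduced_word (g @ [i, j, i]) w" by simp
  have "word_perm [i, j, i] = word_perm [j, i, j]"
    using sgen_braid[OF ij(3)] by (simp add: word_perm_Cons comp_assoc)
  then have "word_perm (g @ [i, j, i]) = word_perm (g @ [j, i, j])"
    unfolding word_perm_append by simp
  then show ?thesis using that[OF g(1) 1] 1 reduced_word_cong[of "g @ [i, j, i]" "g @ [j, i, j]" w] by simp
qed

lemma fa_word_mult: "fa_word as * fa_word bs = fa_word (as @ bs)"
  by (simp add: fa_word_def mult_single plus_free_monoid_def)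

lemma fa_word_Nil: "fa_word [] = 1"
  unfolding fa_word_def zero_free_monoid_def[symmetric] by (simp add: single_one)

lemma fa_word_in_carrier: "set as \<subseteq> B \<Longrightarrow> fa_word as \<in> fa_carrier B"
  by (auto simp: fa_carrier_def fa_word_def)

lemma fa_scalar_in_carrier: "fa_scalar c \<in> fa_carrier B"
  by (auto simp: fa_carrier_def fa_scalar_def zero_free_monoid_def)

definition nc_cong :: "nat \<Rightarrow> (nat, 'r::comm_ring_1) free_algebra \<Rightarrow> (nat, 'r) free_algebra \<Rightarrow> bool" where
  "nc_cong n x y \<longleftrightarrow> x - y \<in> nc_ideal n"

lemma nc_ideal_uminus:
  assumes "x \<in> nc_ideal n"
  shows "- x \<in> nc_ideal n"
proof -
  have "fa_scalar (- 1) * x \<in> nc_ideal n"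
    using assms fa_scalar_in_carrier unfolding nc_ideal_def by (rule ideal_gen.left[rotated])
  moreover have "fa_scalar (- 1) = (- 1 :: (nat, 'a) free_algebra)"
    unfolding fa_scalar_def single_uminus by simp
  ultimately show ?thesis by simp
qed

lemma nc_cong_refl: "nc_cong n x x"
  by (simp add: nc_cong_def nc_ideal_def ideal_gen.zero)

lemma nc_cong_sym: "nc_cong n x y \<Longrightarrow> nc_cong n y x"
  using nc_ideal_uminus[of "x - y" n] by (simp add: nc_cong_def)

lemma nc_cong_add:
  assumes "nc_cong n x y" "nc_cong n x' y'"
  shows "nc_cong n (x + x') (y + y')"
proof -
  have "(x - y) + (x' - y') \<in> nc_ideal n"
    using assms unfolding nc_cong_def nc_ideal_def by (rule ideal_gen.add)
  then show ?thesis by (simp add: nc_cong_def algebra_simps)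
qed

lemma nc_cong_trans:
  assumes "nc_cong n x y" "nc_cong n y z"
  shows "nc_cong n x z"
proof -
  have "(x - y) + (y - z) \<in> nc_ideal n"
    using assms unfolding nc_cong_def nc_ideal_def by (rule ideal_gen.add)
  then show ?thesis by (simp add: nc_cong_def)
qed

lemma nc_cong_left: "nc_cong n x y \<Longrightarrow> r \<in> fa_carrier {..<n} \<Longrightarrow> nc_cong n (r * x) (r * y)"
  by (simp add: nc_cong_def nc_ideal_def ideal_gen.left flip: right_diff_distrib)

lemma nc_cong_right: "nc_cong n x y \<Longrightarrow> r \<in> fa_carrier {..<n} \<Longrightarrow> nc_cong n (x * r) (y * r)"
  by (simp add: nc_cong_def nc_ideal_def ideal_gen.right flip: left_diff_distrib)

lemma nc_cong_gen: "x - y \<in> nc_relations n \<Longrightarrow> nc_cong n x y"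
  unfolding nc_cong_def nc_ideal_def by (rule ideal_gen.gen)

lemma nc_square: "i < n \<Longrightarrow> nc_cong n (fa_word [i, i]) 0"
  by (rule nc_cong_gen) (auto simp: nc_relations_def)

lemma nc_commute:
  assumes "i < n" "j < n" "i \<noteq> j" "hi i \<noteq> lo j" "hi j \<noteq> lo i"
  shows "nc_cong n (fa_word [i, j]) (fa_word [j, i])"
proof (rule nc_cong_gen)
  have *: "{i, j} \<noteq> {0, 2}" "\<not> (0 < i \<and> j = i + 1)" "\<not> (0 < j \<and> i = j + 1)"
    using assms by (auto simp: lo_def hi_def doubleton_eq_iff split: if_splits)
  show "fa_word [i, j] - fa_word [j, i] \<in> nc_relations n"
    unfolding nc_relations_def by (intro UnI2 CollectI exI[of _ i] exI[of _ j] conjI refl assms(1-3) *)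
qed

lemma nc_braid:
  assumes "i < n" "j < n" "hi i = lo j"
  shows "nc_cong n (fa_word [i, j, i]) (fa_word [j, i, j])"
proof (rule nc_cong_gen)
  have "i = 0 \<and> j = 2 \<or> 0 < i \<and> j = i + 1"
    using assms(3) by (auto simp: lo_def hi_def split: if_splits)
  then show "fa_word [i, j, i] - fa_word [j, i, j] \<in> nc_relations n"
    using assms(1,2) unfolding nc_relations_def by blast
qed

text \<open>This is the theorem of Matsumoto and Tits, by induction on the length.  If two reduced words end in
  different letters, both letters are descents, and one passes from one word to the other through two words that
  end in the two forms of the longest element of the rank-two subgroup; consecutive words in this chain
  either share their last letter or differ by one defining relation.\<close>

lemma reduced_words_nc_cong:
  assumes "w \<in> WD n" "2 \<le> n" "reduced_word as w" "reduced_word bs w"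
  shows "nc_cong n (fa_word as) (fa_word bs :: (nat, 'r::comm_ring_1) free_algebra)"
  using assms(1,3,4)
proof (induction "len w" arbitrary: w as bs)
  case 0
  then have "as = []" "bs = []" by (auto simp: reduced_word_def)
  then show ?case by (simp add: nc_cong_refl)
next
  case (Suc m)
  note wi = WD_inf_I[OF Suc.prems(1)]
  have letters: "set as \<subseteq> {..<n}" "set bs \<subseteq> {..<n}"
    using reduced_word_letters_less Suc.prems assms(2) by blast+
  have "as \<noteq> []" "bs \<noteq> []" using Suc.hyps(2) Suc.prems by (auto simp: reduced_word_def)
  then obtain as' i bs' j where as: "as = as' @ [i]" and bs: "bs = bs' @ [j]"
    by (metis append_butlast_last_id)
  have ij: "i < n" "j < n" using letters as bs by auto
  have d: "descent w i" "descent w j" and r: "reduced_word as' (w \<circ> sgen i)" "reduced_word bs' (w \<circ> sgen j)"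
    using reduced_word_snocD Suc.prems as bs by blast+
  have step: "nc_cong n (fa_word (xs @ [k])) (fa_word (ys @ [k]) :: (nat, 'r) free_algebra)"
    if "k < n" "reduced_word (xs @ [k]) w" "reduced_word (ys @ [k]) w" for xs ys k
  proof -
    have "len w = Suc (len (w \<circ> sgen k))"
      by (rule len_descent[OF wi reduced_word_snocD(1)[OF that(2)]])
    then have "nc_cong n (fa_word xs) (fa_word ys :: (nat, 'r) free_algebra)"
      using Suc.hyps(1)[of "w \<circ> sgen k" xs ys] Suc.hyps(2) WD_comp_sgen[OF Suc.prems(1) that(1) assms(2)]
        reduced_word_snocD(2)[OF that(2)] reduced_word_snocD(2)[OF that(3)] by simp
    then have "nc_cong n (fa_word xs * fa_word [k]) (fa_word ys * fa_word [k] :: (nat, 'r) free_algebra)"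
      using that(1) by (intro nc_cong_right fa_word_in_carrier) auto
    then show ?thesis by (simp add: fa_word_mult)
  qed
  have main: "nc_cong n (fa_word as) (fa_word bs :: (nat, 'r) free_algebra)"
    if "set g \<subseteq> {..<n}" "reduced_word (g @ u @ [i]) w" "reduced_word (g @ v @ [j]) w"
      "nc_cong n (fa_word (u @ [i])) (fa_word (v @ [j]) :: (nat, 'r) free_algebra)" for g u v
  proof -
    have "nc_cong n (fa_word g * fa_word (u @ [i])) (fa_word g * fa_word (v @ [j]) :: (nat, 'r) free_algebra)"
      using that(1,4) by (intro nc_cong_left fa_word_in_carrier)
    then have "nc_cong n (fa_word ((g @ u) @ [i])) (fa_word ((g @ v) @ [j]) :: (nat, 'r) free_algebra)"
      by (simp add: fa_word_mult)
    moreover have "nc_cong n (fa_word as) (fa_word ((g @ u) @ [i]) :: (nat, 'r) free_algebra)"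
      unfolding as using step[OF ij(1), of as' "g @ u"] Suc.prems(2) that(2) as by simp
    moreover have "nc_cong n (fa_word ((g @ v) @ [j])) (fa_word bs :: (nat, 'r) free_algebra)"
      unfolding bs using step[OF ij(2), of "g @ v" bs'] Suc.prems(3) that(3) bs by simp
    ultimately show ?thesis by (meson nc_cong_trans)
  qed
  consider "i = j" | "hi i = lo j" | "hi j = lo i" | "i \<noteq> j" "hi i \<noteq> lo j" "hi j \<noteq> lo i" by blast
  then show ?case
  proof cases
    case 1
    then show ?thesis using step[OF ij(1), of as' bs'] Suc.prems as bs by simp
  next
    case 2
    obtain g where "set g \<subseteq> {..<n}" "reduced_word (g @ [i, j, i]) w" "reduced_word (g @ [j, i, j]) w"
      by (rule reduced_word_two_descents_braid[OF Suc.prems(1) assms(2) ij 2 d])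
    then show ?thesis using main[of g "[i, j]" "[j, i]"] nc_braid[OF ij 2] by simp
  next
    case 3
    obtain g where "set g \<subseteq> {..<n}" "reduced_word (g @ [j, i, j]) w" "reduced_word (g @ [i, j, i]) w"
      by (rule reduced_word_two_descents_braid[OF Suc.prems(1) assms(2) ij(2,1) 3 d(2,1)])
    then show ?thesis using main[of g "[i, j]" "[j, i]"] nc_cong_sym[OF nc_braid[OF ij(2,1) 3]] by simp
  next
    case 4
    obtain g where "set g \<subseteq> {..<n}" "reduced_word (g @ [j, i]) w" "reduced_word (g @ [i, j]) w"
      by (rule reduced_word_two_descents_commute[OF Suc.prems(1) assms(2) ij 4 d])
    then show ?thesis using main[of g "[j]" "[i]"] nc_commute[OF ij(2,1)] 4 by simp
  qed
qed

text \<open>At the first letter \<open>k\<close> that makes the word non-reduced, the prefix has the descent \<open>k\<close>, hence is equivalent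
  to a word ending in \<open>k\<close>, and a square appears.\<close>

lemma nonreduced_word_nc_cong:
  assumes "set as \<subseteq> {..<n}" "2 \<le> n" "\<not> reduced_word as (word_perm as)"
  shows "nc_cong n (fa_word as) (0 :: (nat, 'r::comm_ring_1) free_algebra)"
  using assms(1,3)
proof (induction as rule: rev_induct)
  case Nil
  have "len id = 0" using len_le[of "[]" id] by simp
  then show ?case using Nil by (simp add: reduced_word_def id_def)
next
  case (snoc k as)
  let ?v = "word_perm as"
  have k: "k < n" and as: "set as \<subseteq> {..<n}" using snoc.prems by auto
  have ck: "fa_word [k] \<in> fa_carrier {..<n}" using k by (intro fa_word_in_carrier) auto
  show ?case
  proof (cases "reduced_word as ?v")
    case False
    then have "nc_cong n (fa_word as * fa_word [k]) (0 * fa_word [k] :: (nat, 'r) free_algebra)"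
      using snoc.IH as ck by (intro nc_cong_right) auto
    then show ?thesis by (simp add: fa_word_mult)
  next
    case True
    have v: "?v \<in> WD n" by (rule word_perm_in_WD[OF as assms(2)])
    have d: "descent ?v k"
    proof (rule ccontr)
      assume nd: "\<not> descent ?v k"
      have v': "?v \<circ> sgen k \<in> WD_inf" by (intro WD_inf_comp_sgen word_perm_in_WD_inf)
      have "\<not> ?v (hi k) < ?v (lo k)" using nd descent_iff[OF WD_inf_I[OF v]] by blast
      then have "descent (?v \<circ> sgen k) k"
        using WD_ascent_or_descent[OF WD_inf_I[OF v], of k] descent_iff[OF v', of k] by auto
      then have "reduced_word (as @ [k]) (?v \<circ> sgen k)"
        using True by (intro reduced_word_snocI[OF v']) simp_all
      then show False using snoc.prems(2) by (simp add: o_def)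
    qed
    obtain g where g: "set g \<subseteq> {..<n}" "reduced_word g (?v \<circ> sgen k)"
      using reduced_word_exists[OF WD_comp_sgen[OF v k assms(2)] assms(2)] .
    have "reduced_word (g @ [k]) ?v" by (rule reduced_word_snocI[OF WD_inf_I[OF v] d g(2)])
    then have "nc_cong n (fa_word as) (fa_word (g @ [k]) :: (nat, 'r) free_algebra)"
      using reduced_words_nc_cong[OF v assms(2) True] by blast
    then have "nc_cong n (fa_word as * fa_word [k]) (fa_word (g @ [k]) * fa_word [k] :: (nat, 'r) free_algebra)"
      using ck by (rule nc_cong_right)
    then have 1: "nc_cong n (fa_word (as @ [k])) (fa_word g * fa_word [k, k] :: (nat, 'r) free_algebra)"
      by (simp add: fa_word_mult)
    have "nc_cong n (fa_word g * fa_word [k, k]) (fa_word g * 0 :: (nat, 'r) free_algebra)"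
      using nc_square[OF k] g(1) by (intro nc_cong_left fa_word_in_carrier)
    with 1 show ?thesis by (metis nc_cong_trans mult_zero_right)
  qed
qed

text \<open>The coefficient of \<open>u\<^sub>w\<close> is read off from a representative by adding the coefficients of all reduced
  words of \<open>w\<close>.  That this is well defined on classes is the linear independence of the \<open>u\<^sub>w\<close>;
  it needs no module to act on, because every defining relation either identifies two words of equal length and
  equal permutation or kills words that are not reduced.\<close>

definition reduced_coeff :: "(int \<Rightarrow> int) \<Rightarrow> (nat, 'r::comm_ring_1) free_algebra \<Rightarrow> 'r" where
  "reduced_coeff w \<xi> = (\<Sum>g \<in> Poly_Mapping.keys \<xi>. Poly_Mapping.lookup \<xi> g * of_bool (reduced_word (letters g) w))"

lemma reduced_coeff_superset:
  assumes "finite A" "Poly_Mapping.keys \<xi> \<subseteq> A"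
  shows "reduced_coeff w \<xi> = (\<Sum>g \<in> A. Poly_Mapping.lookup \<xi> g * of_bool (reduced_word (letters g) w))"
  unfolding reduced_coeff_def
  by (rule sum.mono_neutral_left) (use assms in \<open>auto simp: in_keys_iff\<close>)

lemma reduced_coeff_add: "reduced_coeff w (x + y) = reduced_coeff w x + reduced_coeff w y"
proof -
  let ?A = "Poly_Mapping.keys x \<union> Poly_Mapping.keys y"
  have "Poly_Mapping.keys (x + y) \<subseteq> ?A" by (rule keys_add)
  then show ?thesis
    by (simp add: reduced_coeff_superset[of ?A] lookup_add distrib_right sum.distrib)
qed

lemma reduced_coeff_zero: "reduced_coeff w 0 = 0"
  by (simp add: reduced_coeff_def)

lemma reduced_coeff_diff: "reduced_coeff w (x - y) = reduced_coeff w x - reduced_coeff w y"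
  using reduced_coeff_add[of w "x - y" y] by simp

lemma reduced_coeff_sum: "reduced_coeff w (sum f A) = (\<Sum>a\<in>A. reduced_coeff w (f a))"
  by (induction A rule: infinite_finite_induct) (auto simp: reduced_coeff_zero reduced_coeff_add)

lemma reduced_coeff_single:
  "reduced_coeff w (Poly_Mapping.single g c) = c * of_bool (reduced_word (letters g) w)"
  by (subst reduced_coeff_superset[of "{g}"]) auto

lemma free_algebra_sum_singles:
  "x = (\<Sum>g \<in> Poly_Mapping.keys x. Poly_Mapping.single g (Poly_Mapping.lookup x g))"
proof (rule poly_mapping_eqI)
  fix h
  have "Poly_Mapping.lookup (\<Sum>g \<in> Poly_Mapping.keys x. Poly_Mapping.single g (Poly_Mapping.lookup x g)) h
    = (\<Sum>g \<in> Poly_Mapping.keys x. if g = h then Poly_Mapping.lookup x g else 0)"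
    unfolding lookup_sum by (intro sum.cong) (auto simp: lookup_single)
  also have "\<dots> = Poly_Mapping.lookup x h"
    by (simp add: sum.delta in_keys_iff)
  finally show "Poly_Mapping.lookup x h = Poly_Mapping.lookup
    (\<Sum>g \<in> Poly_Mapping.keys x. Poly_Mapping.single g (Poly_Mapping.lookup x g)) h" by simp
qed

lemma reduced_coeff_two_sided:
  assumes "\<And>g h c d. reduced_coeff w (Poly_Mapping.single g c * x * Poly_Mapping.single h d) = 0"
  shows "reduced_coeff w (r * x * s) = 0"
  by (subst free_algebra_sum_singles[of r], subst free_algebra_sum_singles[of s])
    (simp add: sum_distrib_left sum_distrib_right reduced_coeff_sum assms)

lemma reduced_coeff_equal_words:
  assumes "word_perm as = word_perm bs" "length as = length bs"
  shows "reduced_coeff w (r * (fa_word as - fa_word bs) * s) = 0"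
proof (rule reduced_coeff_two_sided)
  fix g h and c d :: 'a
  have "word_perm (letters g @ as @ letters h) = word_perm (letters g @ bs @ letters h)"
    using assms by (simp add: fun_eq_iff)
  then have "reduced_word (letters g @ as @ letters h) w = reduced_word (letters g @ bs @ letters h) w"
    using assms(2) by (intro reduced_word_cong) simp_all
  then show "reduced_coeff w (Poly_Mapping.single g c * (fa_word as - fa_word bs) * Poly_Mapping.single h d) = 0"
    by (simp add: fa_word_def right_diff_distrib left_diff_distrib mult_single reduced_coeff_diff
        reduced_coeff_single plus_free_monoid_def)
qed

lemma not_reduced_square: "\<not> reduced_word (g @ [i, i] @ h) w"
proof
  assume r: "reduced_word (g @ [i, i] @ h) w"
  then have "word_perm (g @ h) = w"
    by (auto simp: reduced_word_def word_perm_Cons fun_eq_iff)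
  then show False using len_le[of "g @ h" w] r by (simp add: reduced_word_def)
qed

lemma reduced_coeff_square: "reduced_coeff w (r * fa_word [i, i] * s) = 0"
proof (rule reduced_coeff_two_sided)
  fix g h and c d :: 'a
  show "reduced_coeff w (Poly_Mapping.single g c * fa_word [i, i] * Poly_Mapping.single h d) = 0"
    using not_reduced_square[of "letters g" i "letters h" w]
    by (simp add: fa_word_def mult_single reduced_coeff_single plus_free_monoid_def)
qed

lemma word_perm_relations:
  shows "word_perm [0, 1] = word_perm [1, 0]"
    and "word_perm [0, 2, 0] = word_perm [2, 0, 2]"
    and "0 < i \<Longrightarrow> word_perm [i, i + 1, i] = word_perm [i + 1, i, i + 1]"
    and "i \<noteq> j \<Longrightarrow> {i, j} \<noteq> {0, 2} \<Longrightarrow> \<not> (0 < i \<and> j = i + 1) \<Longrightarrow> \<not> (0 < j \<and> i = j + 1)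
      \<Longrightarrow> word_perm [i, j] = word_perm [j, i]"
proof -
  have c: "word_perm [i, j] = word_perm [j, i]" if "i \<noteq> j" "hi i \<noteq> lo j" "hi j \<noteq> lo i" for i j
    using sgen_commute(2)[OF that] by (simp add: word_perm_Cons)
  have b: "word_perm [i, j, i] = word_perm [j, i, j]" if "hi i = lo j" for i j
    using sgen_braid[OF that] by (simp add: word_perm_Cons comp_assoc)
  show "word_perm [0, 1] = word_perm [1, 0]" by (rule c) (auto simp: lo_def hi_def)
  show "word_perm [0, 2, 0] = word_perm [2, 0, 2]" by (rule b) (auto simp: lo_def hi_def)
  show "word_perm [i, i + 1, i] = word_perm [i + 1, i, i + 1]" if "0 < i"
    by (rule b) (use that in \<open>auto simp: lo_def hi_def\<close>)
  show "word_perm [i, j] = word_perm [j, i]"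
    if "i \<noteq> j" "{i, j} \<noteq> {0, 2}" "\<not> (0 < i \<and> j = i + 1)" "\<not> (0 < j \<and> i = j + 1)"
    by (rule c) (use that in \<open>auto simp: lo_def hi_def split: if_splits\<close>)
qed

lemma reduced_coeff_relations:
  assumes "x \<in> nc_relations n"
  shows "reduced_coeff w (r * x * s) = 0"
proof -
  consider (sq) i where "x = fa_word [i, i]"
    | (eq) as bs where "x = fa_word as - fa_word bs" "word_perm as = word_perm bs" "length as = length bs"
  proof -
    assume sq: "\<And>i. x = fa_word [i, i] \<Longrightarrow> thesis"
      and eq: "\<And>as bs. x = fa_word as - fa_word bs \<Longrightarrow> word_perm as = word_perm bs
        \<Longrightarrow> length as = length bs \<Longrightarrow> thesis"
    show thesis
      using assms unfolding nc_relations_def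
    proof (elim UnE)
      assume "x \<in> {fa_word [i, i] |i. i < n}"
      then show thesis using sq by blast
    next
      assume "x \<in> {fa_word [0, 1] - fa_word [1, 0]}"
      then show thesis using eq[OF _ word_perm_relations(1)] by simp
    next
      assume "x \<in> {r. r = fa_word [0, 2, 0] - fa_word [2, 0, 2] \<and> 2 < n}"
      then show thesis using eq[OF _ word_perm_relations(2)] by simp
    next
      assume "x \<in> {fa_word [i, i + 1, i] - fa_word [i + 1, i, i + 1] |i. 0 < i \<and> i + 1 < n}"
      then obtain i where "0 < i" "x = fa_word [i, i + 1, i] - fa_word [i + 1, i, i + 1]" by blast
      then show thesis using eq[of "[i, i + 1, i]" "[i + 1, i, i + 1]"] word_perm_relations(3)[of i] by simp
    next
      assume "x \<in> {fa_word [i, j] - fa_word [j, i] |i j. i < n \<and> j < n \<and> i \<noteq> j \<and> {i, j} \<noteq> {0, 2}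
        \<and> \<not> (0 < i \<and> j = i + 1) \<and> \<not> (0 < j \<and> i = j + 1)}"
      then show thesis
      proof (elim CollectE exE conjE)
        fix i j assume x: "x = fa_word [i, j] - fa_word [j, i]"
          and ij: "i \<noteq> j" "{i, j} \<noteq> {0, 2}" "\<not> (0 < i \<and> j = i + 1)" "\<not> (0 < j \<and> i = j + 1)"
        show thesis by (rule eq[OF x word_perm_relations(4)[OF ij]]) simp
      qed
    qed
  qed
  then show ?thesis
    by cases (simp_all only: reduced_coeff_square reduced_coeff_equal_words)
qed

lemma reduced_coeff_ideal:
  assumes "x \<in> nc_ideal n"
  shows "reduced_coeff w x = 0"
proof -
  have "reduced_coeff w (r * x * s) = 0" for r s
    using assms unfolding nc_ideal_def
  proof (induction arbitrary: r s)
    case zero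
    then show ?case by (simp add: reduced_coeff_zero)
  next
    case (gen x)
    then show ?case by (rule reduced_coeff_relations)
  next
    case (add a b)
    then show ?case by (simp add: algebra_simps reduced_coeff_add)
  next
    case (left q a)
    then show ?case using left.IH[of "r * q" s] by (simp add: mult.assoc)
  next
    case (right q a)
    then show ?case using right.IH[of r "q * s"] by (simp add: mult.assoc)
  qed
  from this[of 1 1] show ?thesis by simp
qed

definition canonical_word :: "nat \<Rightarrow> (int \<Rightarrow> int) \<Rightarrow> nat list" where
  "canonical_word n w = (SOME as. set as \<subseteq> {..<n} \<and> reduced_word as w)"

lemma canonical_word_reduced:
  assumes "w \<in> WD n" "2 \<le> n"
  shows "set (canonical_word n w) \<subseteq> {..<n}" "reduced_word (canonical_word n w) w"
proof -
  obtain as where "set as \<subseteq> {..<n}" "reduced_word as w" by (rule reduced_word_exists[OF assms])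
  then have "\<exists>as. set as \<subseteq> {..<n} \<and> reduced_word as w" by (intro exI conjI)
  then have "set (canonical_word n w) \<subseteq> {..<n} \<and> reduced_word (canonical_word n w) w"
    unfolding canonical_word_def by (rule someI_ex)
  then show "set (canonical_word n w) \<subseteq> {..<n}" "reduced_word (canonical_word n w) w" by auto
qed

lemma nc_basis_canonical: "nc_basis n w = fa_word (canonical_word n w)"
  by (simp add: nc_basis_def canonical_word_def)

lemma reduced_coeff_basis_sum:
  assumes "2 \<le> n" "w \<in> WD n"
  shows "reduced_coeff w (\<Sum>v\<in>WD n. fa_scalar (c v) * nc_basis n v) = c w"
proof -
  have "reduced_coeff w (\<Sum>v\<in>WD n. fa_scalar (c v) * nc_basis n v)
      = (\<Sum>v\<in>WD n. if v = w then c v else 0)"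
    unfolding reduced_coeff_sum
  proof (intro sum.cong refl)
    fix v assume v: "v \<in> WD n"
    have "reduced_word (canonical_word n v) w \<longleftrightarrow> v = w"
      using canonical_word_reduced[OF v assms(1)] by (auto simp: reduced_word_def)
    then show "reduced_coeff w (fa_scalar (c v) * nc_basis n v) = (if v = w then c v else 0)"
      by (simp add: nc_basis_canonical fa_scalar_def fa_word_def mult_single reduced_coeff_single)
  qed
  then show ?thesis using assms by (simp add: finite_WD)
qed

text \<open>Uniqueness of the decomposition is what gives the definite description in \<open>nc_coeff\<close> its value: any
  decomposition has the values of \<open>reduced_coeff\<close> as its coefficients.\<close>

lemma nc_coeff_eqI:
  assumes n: "2 \<le> n" "w \<in> WD n"
    and dec: "nc_cong n \<xi> (\<Sum>v\<in>WD n. fa_scalar (c v) * nc_basis n v)"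
  shows "nc_coeff n \<xi> w = c w"
proof -
  define c' where "c' = (\<lambda>v. if v \<in> WD n then c v else 0)"
  have "(\<Sum>v\<in>WD n. fa_scalar (c v) * nc_basis n v) = (\<Sum>v\<in>WD n. fa_scalar (c' v) * nc_basis n v)"
    by (intro sum.cong) (auto simp: c'_def)
  with dec have dec': "\<xi> - (\<Sum>v\<in>WD n. fa_scalar (c' v) * nc_basis n v) \<in> nc_ideal n"
    by (simp add: nc_cong_def)
  have red: "d v = reduced_coeff v \<xi>"
    if "\<xi> - (\<Sum>v\<in>WD n. fa_scalar (d v) * nc_basis n v) \<in> nc_ideal n" "v \<in> WD n" for d v
    using reduced_coeff_ideal[OF that(1), of v] reduced_coeff_basis_sum[OF n(1) that(2), of d]
    by (simp add: reduced_coeff_diff)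
  have "(THE c. (\<forall>v. v \<notin> WD n \<longrightarrow> c v = 0) \<and> \<xi> - (\<Sum>v\<in>WD n. fa_scalar (c v) * nc_basis n v) \<in> nc_ideal n) = c'"
  proof (rule the_equality)
    fix d assume d: "(\<forall>v. v \<notin> WD n \<longrightarrow> d v = 0) \<and> \<xi> - (\<Sum>v\<in>WD n. fa_scalar (d v) * nc_basis n v) \<in> nc_ideal n"
    show "d = c'"
    proof
      fix v show "d v = c' v"
        using d red[of d v] red[OF dec', of v] by (cases "v \<in> WD n") (auto simp: c'_def)
    qed
  qed (use dec' in \<open>auto simp: c'_def\<close>)
  then show ?thesis unfolding nc_coeff_def using n(2) by (simp add: c'_def)
qed

section \<open>Coefficients of products of linear factors\<close>

text \<open>All series that occur are products of factors \<open>1 + t u\<^sub>k\<close>.  Such a product is encoded by the list of its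
  pairs \<open>(k, t)\<close>, and from here on the nilCoxeter algebra is replaced by operations on these lists.\<close>

definition factor_prod :: "(nat \<times> 'r::comm_ring_1) list \<Rightarrow> (nat, 'r) free_algebra" where
  "factor_prod L = prod_list (map (\<lambda>(k, t). nc_fac t k) L)"

text \<open>This is the coefficient of \<open>u\<^sub>w\<close> in \<open>u\<^sub>g\<close> times the product encoded by the list, times \<open>u\<^sub>h\<close>.  The two
  extra words make the function recursive in the first factor and, by
  \<open>factor_coeff_snoc\<close> below, also in the last one.\<close>

primrec factor_coeff :: "(int \<Rightarrow> int) \<Rightarrow> nat list \<Rightarrow> nat list \<Rightarrow> (nat \<times> 'r::comm_ring_1) list \<Rightarrow> 'r" where
  "factor_coeff w g h [] = of_bool (reduced_word (g @ h) w)"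
| "factor_coeff w g h (x # L) = factor_coeff w g h L + snd x * factor_coeff w (g @ [fst x]) h L"

lemma fa_scalar_add: "fa_scalar (a + b) = fa_scalar a + fa_scalar b"
  by (simp add: fa_scalar_def single_add)

lemma fa_scalar_mult: "fa_scalar (a * b) = fa_scalar a * fa_scalar b"
  by (simp add: fa_scalar_def mult_single)

text \<open>Multiplying out gives a combination of words.  A reduced word is equivalent to the chosen word of the same
  permutation, any other word to zero.\<close>

lemma factor_prod_decomposition:
  assumes "2 \<le> n" "set g \<subseteq> {..<n}" "fst ` set L \<subseteq> {..<n}"
  shows "nc_cong n (fa_word g * factor_prod L) (\<Sum>v\<in>WD n. fa_scalar (factor_coeff v g [] L) * nc_basis n v)"
  using assms(2,3)
proof (induction L arbitrary: g)
  case Nil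
  let ?w = "word_perm g"
  have w: "?w \<in> WD n" using word_perm_in_WD assms Nil by blast
  have z: "fa_scalar 0 = 0" by (simp add: fa_scalar_def)
  have o: "fa_scalar 1 = 1" by (simp add: fa_scalar_def)
  show ?case
  proof (cases "reduced_word g ?w")
    case True
    have "(\<Sum>v\<in>WD n. fa_scalar (factor_coeff v g [] []) * nc_basis n v)
        = (\<Sum>v\<in>WD n. if v = ?w then nc_basis n v else (0 :: (nat, 'a) free_algebra))"
      using True by (intro sum.cong) (auto simp: reduced_word_def z o)
    also have "\<dots> = nc_basis n ?w" using w by (simp add: finite_WD)
    finally show ?thesis
      using reduced_words_nc_cong[OF w assms(1) True canonical_word_reduced(2)[OF w assms(1)]]
      by (simp add: factor_prod_def nc_basis_canonical)
  next
    case False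
    have "(\<Sum>v\<in>WD n. fa_scalar (factor_coeff v g [] []) * nc_basis n v) = (0 :: (nat, 'a) free_algebra)"
      using False by (intro sum.neutral) (auto simp: reduced_word_def z)
    then show ?thesis
      using nonreduced_word_nc_cong[OF Nil(1) assms(1) False] by (simp add: factor_prod_def)
  qed
next
  case (Cons x L)
  obtain k t where x: "x = (k, t)" by (cases x)
  have k: "k < n" and L: "fst ` set L \<subseteq> {..<n}" using Cons.prems x by auto
  have comm: "fa_word g * fa_scalar t = fa_scalar t * fa_word g"
    by (simp add: fa_word_def fa_scalar_def mult_single)
  have "fa_word g * factor_prod (x # L) = fa_word g * factor_prod L + fa_word g * fa_scalar t * fa_word [k] * factor_prod L"
    by (simp add: factor_prod_def x nc_fac_def algebra_simps)
  also have "\<dots> = fa_word g * factor_prod L + fa_scalar t * (fa_word (g @ [k]) * factor_prod L)"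
    unfolding comm by (simp add: mult.assoc flip: fa_word_mult)
  finally have 1: "fa_word g * factor_prod (x # L) = \<dots>" .
  have "nc_cong n (fa_word g * factor_prod L + fa_scalar t * (fa_word (g @ [k]) * factor_prod L))
     ((\<Sum>v\<in>WD n. fa_scalar (factor_coeff v g [] L) * nc_basis n v)
       + fa_scalar t * (\<Sum>v\<in>WD n. fa_scalar (factor_coeff v (g @ [k]) [] L) * nc_basis n v))"
    using Cons.prems k L by (intro nc_cong_add nc_cong_left Cons.IH fa_scalar_in_carrier) auto
  moreover have "(\<Sum>v\<in>WD n. fa_scalar (factor_coeff v g [] L) * nc_basis n v)
       + fa_scalar t * (\<Sum>v\<in>WD n. fa_scalar (factor_coeff v (g @ [k]) [] L) * nc_basis n v)
     = (\<Sum>v\<in>WD n. fa_scalar (factor_coeff v g [] (x # L)) * nc_basis n v)"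
    by (simp add: x fa_scalar_add fa_scalar_mult distrib_right sum.distrib sum_distrib_left mult.assoc)
  ultimately show ?case unfolding 1 by simp
qed

theorem nc_coeff_factor_prod:
  assumes "2 \<le> n" "w \<in> WD n" "fst ` set L \<subseteq> {..<n}"
  shows "nc_coeff n (factor_prod L) w = factor_coeff w [] [] L"
  using nc_coeff_eqI[OF assms(1,2)] factor_prod_decomposition[OF assms(1) _ assms(3), of "[]"]
  by (simp add: fa_word_Nil)


lemma factor_coeff_word_cong:
  "word_perm g = word_perm g' \<Longrightarrow> length g = length g' \<Longrightarrow> factor_coeff w g h L = factor_coeff w g' h L"
proof (induction L arbitrary: g g')
  case Nil
  then show ?case using reduced_word_cong[of "g @ h" "g' @ h" w] by simp
next
  case (Cons x L)
  have "word_perm (g @ [fst x]) = word_perm (g' @ [fst x])"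
    unfolding word_perm_append Cons.prems(1) ..
  then have "factor_coeff w (g @ [fst x]) h L = factor_coeff w (g' @ [fst x]) h L"
    using Cons.prems(2) by (intro Cons.IH) simp_all
  then show ?case using Cons.IH[OF Cons.prems] by (simp only: factor_coeff.simps)
qed

lemma factor_coeff_square: "factor_coeff w (g @ [i, i] @ g') h L = 0"
proof (induction L arbitrary: g')
  case Nil
  show ?case using not_reduced_square[of g i "g' @ h" w] by simp
next
  case (Cons x L)
  then show ?case using Cons.IH[of g'] Cons.IH[of "g' @ [fst x]"] by simp
qed

lemma factor_coeff_square_last: "factor_coeff w (g @ [i, i]) h L = 0"
  using factor_coeff_square[of w g i "[]" h L] by simp

section \<open>Yang-Baxter relation and commutation of series\<close>

text \<open>Equality of the two products in the nilCoxeter algebra, expressed through coefficients.  Trailing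
  factors \<open>R\<close> are part of the definition so that it becomes a congruence.\<close>

definition factor_equiv :: "(nat \<times> 'r::comm_ring_1) list \<Rightarrow> (nat \<times> 'r) list \<Rightarrow> bool" where
  "factor_equiv L M \<longleftrightarrow> (\<forall>w g h R. factor_coeff w g h (L @ R) = factor_coeff w g h (M @ R))"

lemma factor_equiv_refl: "factor_equiv L L"
  by (simp add: factor_equiv_def)

lemma factor_equiv_sym: "factor_equiv L M \<Longrightarrow> factor_equiv M L"
  by (simp add: factor_equiv_def)

lemma factor_equiv_trans [trans]: "factor_equiv L M \<Longrightarrow> factor_equiv M N \<Longrightarrow> factor_equiv L N"
  by (simp add: factor_equiv_def)

lemma factor_equiv_context:
  assumes "factor_equiv L M"
  shows "factor_equiv (A @ L @ B) (A @ M @ B)"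
proof -
  have "factor_coeff w g h (A @ L @ B @ R) = factor_coeff w g h (A @ M @ B @ R)" for w g h R
    by (induction A arbitrary: g) (use assms in \<open>simp_all add: factor_equiv_def\<close>)
  then show ?thesis by (simp add: factor_equiv_def)
qed

lemma factor_equiv_append:
  assumes "factor_equiv L L'" "factor_equiv M M'"
  shows "factor_equiv (L @ M) (L' @ M')"
  using factor_equiv_context[OF assms(1), of "[]" M] factor_equiv_context[OF assms(2), of L' "[]"]
  by (simp add: factor_equiv_def)

lemma factor_equiv_factor_coeff: "factor_equiv L M \<Longrightarrow> factor_coeff w g h (A @ L @ B) = factor_coeff w g h (A @ M @ B)"
  using factor_equiv_context[of L M A B] unfolding factor_equiv_def by (metis append_Nil2)

lemma factor_equiv_zero: "factor_equiv [(k, 0)] []"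
  by (simp add: factor_equiv_def)

lemma factor_equiv_merge: "factor_equiv [(i, s), (i, t)] [(i, s + t)]"
  by (simp add: factor_equiv_def factor_coeff_square_last algebra_simps)

lemma factor_equiv_commute:
  fixes s t :: "'r::comm_ring_1"
  assumes "i \<noteq> j" "hi i \<noteq> lo j" "hi j \<noteq> lo i"
  shows "factor_equiv [(i, s), (j, t)] [(j, t), (i, s)]"
proof -
  have "word_perm [i, j] = word_perm [j, i]"
    using sgen_commute(2)[OF assms] by (simp add: word_perm_Cons)
  then have "factor_coeff w (g @ [i, j]) h L = factor_coeff w (g @ [j, i]) h L" for w g h and L :: "(nat \<times> 'r) list"
    by (intro factor_coeff_word_cong) (simp_all only: word_perm_append length_append, simp)
  then show ?thesis by (simp add: factor_equiv_def algebra_simps)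
qed

text \<open>On both sides the linear terms have the coefficient \<open>s + t\<close>, the squares vanish, the mixed quadratic terms
  agree, and the cubic terms agree by the braid relation.\<close>

lemma factor_equiv_yang_baxter:
  fixes s t :: "'r::comm_ring_1"
  assumes "hi i = lo j"
  shows "factor_equiv [(i, s), (j, s + t), (i, t)] [(j, t), (i, s + t), (j, s)]"
proof -
  have "word_perm [i, j, i] = word_perm [j, i, j]"
    using sgen_braid[OF assms] by (simp add: word_perm_Cons comp_assoc)
  then have "factor_coeff w (g @ [i, j, i]) h L = factor_coeff w (g @ [j, i, j]) h L" for w g h and L :: "(nat \<times> 'r) list"
    by (intro factor_coeff_word_cong) (simp_all only: word_perm_append length_append, simp)
  then show ?thesis
    by (simp add: factor_equiv_def factor_coeff_square_last algebra_simps)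
qed

definition commuting :: "nat \<Rightarrow> nat \<Rightarrow> bool" where
  "commuting i k \<longleftrightarrow> i \<noteq> k \<and> hi i \<noteq> lo k \<and> hi k \<noteq> lo i"

lemma commuting_far: "0 < i \<Longrightarrow> Suc i < k \<Longrightarrow> commuting i k"
  by (auto simp: commuting_def lo_def hi_def)

lemma factor_equiv_commute_letter:
  assumes "\<And>k. k \<in> fst ` set L \<Longrightarrow> commuting i k"
  shows "factor_equiv (L @ [(i, t)]) ((i, t) # L)"
  using assms
proof (induction L)
  case Nil
  show ?case by (simp add: factor_equiv_refl)
next
  case (Cons x L)
  obtain k s where x: "x = (k, s)" by (cases x)
  have "factor_equiv ([x] @ L @ [(i, t)]) ([x] @ [(i, t)] @ L)"
    using factor_equiv_append[OF factor_equiv_refl[of "[x]"] Cons.IH] Cons.prems by simp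
  also have "factor_equiv ([x] @ [(i, t)] @ L) ([(i, t), x] @ L)"
  proof -
    have "commuting i k" using Cons.prems[of k] x by simp
    then have "k \<noteq> i" "hi k \<noteq> lo i" "hi i \<noteq> lo k" by (auto simp: commuting_def)
    then have "factor_equiv [(k, s), (i, t)] [(i, t), (k, s)]" by (rule factor_equiv_commute)
    from factor_equiv_append[OF this factor_equiv_refl[of L]] show ?thesis by (simp add: x)
  qed
  finally show ?case by simp
qed

lemma factor_equiv_commute_lists:
  assumes "\<And>i k. i \<in> fst ` set M \<Longrightarrow> k \<in> fst ` set L \<Longrightarrow> commuting i k"
  shows "factor_equiv (L @ M) (M @ L)"
  using assms
proof (induction M)
  case Nil
  show ?case by (simp add: factor_equiv_refl)
next
  case (Cons x M)
  obtain i t where x: "x = (i, t)" by (cases x)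
  have "factor_equiv (L @ [(i, t)]) ((i, t) # L)"
    by (rule factor_equiv_commute_letter) (use Cons.prems x in auto)
  then have "factor_equiv ((L @ [x]) @ M) ((x # L) @ M)"
    unfolding x by (rule factor_equiv_append[OF _ factor_equiv_refl])
  moreover have "factor_equiv ([x] @ L @ M) ([x] @ M @ L)"
    by (rule factor_equiv_append[OF factor_equiv_refl Cons.IH]) (use Cons.prems in auto)
  ultimately show ?case using factor_equiv_trans by auto
qed

text \<open>The list \<open>row n i t\<close> encodes \<open>(1 + t u\<^sub>i) \<cdots> (1 + t u\<^sub>n\<^sub>-\<^sub>1)\<close>, which is the series with a tilde at \<open>- t\<close>; its
  reversal encodes the series without a tilde at \<open>t\<close>.\<close>

definition row :: "nat \<Rightarrow> nat \<Rightarrow> 'r::comm_ring_1 \<Rightarrow> (nat \<times> 'r) list" where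
  "row n i t = map (\<lambda>k. (k, t)) [i..<n]"

lemma row_Cons: "i < n \<Longrightarrow> row n i t = (i, t) # row n (Suc i) t"
  by (simp add: row_def upt_conv_Cons)

lemma fst_set_row: "fst ` set (row n i t) = {i..<n}"
  by (force simp: row_def)

text \<open>The left side is the part of the product of two rows that remains when the rows starting at \<open>j\<close> are
  split off.  It is symmetric in \<open>s\<close> and \<open>t\<close>: write \<open>s = t + (s - t)\<close> in the first factor and apply the Yang-Baxter
  relation with the parameters \<open>s - t\<close>, \<open>s\<close>, \<open>t\<close>.\<close>

lemma factor_equiv_row_step:
  assumes "hi i = lo j"
  shows "factor_equiv [(i, s), (j, s), (i, t), (j, - s)] [(i, t), (j, t), (i, s), (j, - t)]"
proof -
  have "factor_equiv ([] @ [(i, t), (i, s - t)] @ [(j, s), (i, t), (j, - s)]) ([] @ [(i, s)] @ [(j, s), (i, t), (j, - s)])"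
    using factor_equiv_context[OF factor_equiv_merge[of i t "s - t"], of "[]" "[(j, s), (i, t), (j, - s)]"] by simp
  then have 1: "factor_equiv [(i, s), (j, s), (i, t), (j, - s)] [(i, t), (i, s - t), (j, s), (i, t), (j, - s)]"
    using factor_equiv_sym by simp
  have 2: "factor_equiv [(i, t), (i, s - t), (j, s), (i, t), (j, - s)] [(i, t), (j, t), (i, s), (j, s - t), (j, - s)]"
    using factor_equiv_context[OF factor_equiv_yang_baxter[OF assms, of "s - t" t], of "[(i, t)]" "[(j, - s)]"] by simp
  have 3: "factor_equiv [(i, t), (j, t), (i, s), (j, s - t), (j, - s)] [(i, t), (j, t), (i, s), (j, - t)]"
    using factor_equiv_context[OF factor_equiv_merge[of j "s - t" "- s"], of "[(i, t), (j, t), (i, s)]" "[]"] by simp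
  show ?thesis using 1 2 3 by (blast intro: factor_equiv_trans)
qed

text \<open>Series with different parameters commute, which is why the Stanley functions are symmetric.  This is
  needed because the variables \<open>z\<close> occur in descending order in the Schubert polynomial and in ascending
  order in the Stanley functions.\<close>

lemma factor_equiv_rows:
  assumes "1 \<le> i"
  shows "factor_equiv (row n i s @ row n i t) (row n i t @ row n i s)"
  using assms
proof (induction "n - i" arbitrary: i)
  case 0
  then show ?case by (simp add: row_def factor_equiv_refl)
next
  case (Suc m)
  show ?case
  proof (cases "Suc i < n")
    case False
    then have "n = Suc i" using Suc.hyps(2) by simp
    then have r: "row n i x = [(i, x)]" for x :: 'a by (simp add: row_def)
    have "factor_equiv [(i, s), (i, t)] [(i, s + t)]" by (rule factor_equiv_merge)
    moreover have "factor_equiv [(i, t), (i, s)] [(i, s + t)]"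
      using factor_equiv_merge[of i t s] by (simp add: add.commute)
    ultimately show ?thesis unfolding r using factor_equiv_trans factor_equiv_sym by fastforce
  next
    case True
    let ?j = "Suc i"
    have hl: "hi i = lo ?j" using Suc.prems by (simp add: lo_def hi_def)
    have r: "row n i x = (i, x) # row n ?j x" "row n ?j x = (?j, x) # row n (Suc ?j) x" for x :: 'a
      using True by (simp_all add: row_Cons)
    \<comment> \<open>a cancelling pair of factors is inserted in order to complete the second row of \<open>x\<close>\<close>
    have split: "factor_equiv (row n i x @ row n i y)
        ([(i, x), (?j, x), (i, y), (?j, - x)] @ row n ?j x @ row n ?j y)" for x y :: 'a
    proof -
      have "factor_equiv (row n (Suc ?j) x @ [(i, y)]) ((i, y) # row n (Suc ?j) x)"
        by (rule factor_equiv_commute_letter) (use Suc.prems in \<open>auto simp: fst_set_row intro: commuting_far\<close>)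
      from factor_equiv_context[OF this, of "[(i, x), (?j, x)]" "row n ?j y"]
      have 1: "factor_equiv (row n i x @ row n i y) ([(i, x), (?j, x), (i, y)] @ row n (Suc ?j) x @ row n ?j y)"
        unfolding r(1) by (simp add: r(2)[of x])
      have "factor_equiv [(?j, - x), (?j, x)] []"
        using factor_equiv_trans[OF factor_equiv_merge[of ?j "- x" x]] factor_equiv_zero[of ?j] by simp
      from factor_equiv_context[OF this, of "[(i, x), (?j, x), (i, y)]" "row n (Suc ?j) x @ row n ?j y"]
      have 2: "factor_equiv ([(i, x), (?j, x), (i, y)] @ row n (Suc ?j) x @ row n ?j y)
         ([(i, x), (?j, x), (i, y), (?j, - x)] @ row n ?j x @ row n ?j y)"
        using factor_equiv_sym by (simp add: r(2)[of x])
      show ?thesis using 1 2 by (rule factor_equiv_trans)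
    qed
    have "factor_equiv (row n ?j s @ row n ?j t) (row n ?j t @ row n ?j s)"
      using Suc.hyps True by (intro Suc.hyps(1)) auto
    with factor_equiv_row_step[OF hl]
    have "factor_equiv ([(i, s), (?j, s), (i, t), (?j, - s)] @ (row n ?j s @ row n ?j t))
        ([(i, t), (?j, t), (i, s), (?j, - t)] @ (row n ?j t @ row n ?j s))"
      by (rule factor_equiv_append)
    then show ?thesis using split[of s t] factor_equiv_sym[OF split[of t s]] factor_equiv_trans by blast
  qed
qed

lemma factor_equiv_concat_rev:
  assumes comm: "\<And>s t. factor_equiv (f s @ f t) (f t @ f s)"
  shows "factor_equiv (concat (map f ts)) (concat (map f (rev ts)))"
proof (induction ts)
  case Nil
  show ?case by (simp add: factor_equiv_refl)
next
  case (Cons t ts)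
  have "factor_equiv (f t @ concat (map f us)) (concat (map f us) @ f t)" for us
  proof (induction us)
    case Nil
    show ?case by (simp add: factor_equiv_refl)
  next
    case (Cons u us)
    have "factor_equiv ((f t @ f u) @ concat (map f us)) ((f u @ f t) @ concat (map f us))"
      by (rule factor_equiv_append[OF comm factor_equiv_refl])
    moreover have "factor_equiv (f u @ f t @ concat (map f us)) (f u @ concat (map f us) @ f t)"
      by (rule factor_equiv_append[OF factor_equiv_refl Cons.IH])
    ultimately show ?case by (simp add: factor_equiv_def)
  qed
  moreover have "factor_equiv (concat (map f ts) @ f t) (concat (map f (rev ts)) @ f t)"
    by (rule factor_equiv_append[OF Cons.IH factor_equiv_refl])
  ultimately show ?case using factor_equiv_trans by fastforce
qed

section \<open>Reversal, vanishing and the product rule\<close>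

lemma factor_coeff_snoc: "factor_coeff w g h (L @ [(k, t)]) = factor_coeff w g h L + t * factor_coeff w g (k # h) L"
  by (induction L arbitrary: g) (simp_all add: algebra_simps)

lemma word_perm_rev: "word_perm (rev as) \<circ> word_perm as = id"
  by (induction as) (auto simp: word_perm_Cons fun_eq_iff)

lemma inv_word_perm: "inv (word_perm as) = word_perm (rev as)" and bij_word_perm: "bij (word_perm as)"
proof -
  have 1: "word_perm as \<circ> word_perm (rev as) = id" using word_perm_rev[of "rev as"] by simp
  show "inv (word_perm as) = word_perm (rev as)"
    by (rule inv_unique_comp[OF 1 word_perm_rev])
  show "bij (word_perm as)"
    by (rule o_bij[OF word_perm_rev 1])
qed

lemma WD_inf_word:
  assumes "w \<in> WD_inf"
  obtains as where "word_perm as = w" "length as = len w" "reduced_word as w"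
proof -
  obtain n where "2 \<le> n" "w \<in> WD n" using assms by (rule WD_infE)
  then show ?thesis using reduced_word_exists[of w n] that by (auto simp: reduced_word_def)
qed

lemma WD_inf_bij: "w \<in> WD_inf \<Longrightarrow> bij w"
  by (erule WD_inf_word) (use bij_word_perm in auto)

lemma word_perm_rev_eq_inv:
  assumes "bij w"
  shows "word_perm (rev as) = inv w \<longleftrightarrow> word_perm as = w"
  using assms inv_inv_eq[OF assms] inv_word_perm[of as] inv_word_perm[of "rev as"] by (metis rev_rev_ident)

lemma len_inv:
  assumes "bij w"
  shows "len (inv w) = len w"
proof -
  have "(\<exists>as. length as = k \<and> word_perm as = inv w) = (\<exists>as. length as = k \<and> word_perm as = w)" for k
    using word_perm_rev_eq_inv[OF assms] by (metis length_rev rev_rev_ident)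
  then show ?thesis unfolding len_def by simp
qed

lemma reduced_word_rev: "bij w \<Longrightarrow> reduced_word (rev as) (inv w) \<longleftrightarrow> reduced_word as w"
  by (simp add: reduced_word_def word_perm_rev_eq_inv len_inv)

text \<open>Reversing all products is an anti-automorphism that exchanges \<open>u\<^sub>w\<close> with the basis element of the
  inverse.  It turns statements about right descents into statements about left descents.\<close>

lemma factor_coeff_rev:
  assumes "bij w"
  shows "factor_coeff (inv w) (rev h) (rev g) (rev L) = factor_coeff w g h L"
proof (induction L arbitrary: g)
  case Nil
  show ?case using reduced_word_rev[OF assms, of "g @ h"] by simp
next
  case (Cons x L)
  show ?case using Cons.IH[of g] Cons.IH[of "g @ [fst x]"]
    factor_coeff_snoc[of "inv w" "rev h" "rev g" "rev L" "fst x" "snd x"] by simp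
qed

lemma factor_coeff_eq_0:
  assumes "\<And>as. set as \<subseteq> fst ` set L \<Longrightarrow> \<not> reduced_word (g @ as @ h) w"
  shows "factor_coeff w g h L = 0"
  using assms
proof (induction L arbitrary: g)
  case Nil
  then show ?case by simp
next
  case (Cons x L)
  have "factor_coeff w g h L = 0" by (rule Cons.IH) (use Cons.prems in auto)
  moreover have "factor_coeff w (g @ [fst x]) h L = 0"
  proof (rule Cons.IH)
    fix as assume "set as \<subseteq> fst ` set L"
    then show "\<not> reduced_word ((g @ [fst x]) @ as @ h) w" using Cons.prems[of "fst x # as"] by auto
  qed
  ultimately show ?case by simp
qed

text \<open>Factors with a letter that no reduced word of \<open>w\<close> uses may be dropped.  With the letters below \<open>n\<close> this
  changes the rank, with the letters above \<open>l\<close> it passes to a parabolic subgroup.\<close>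

lemma factor_coeff_filter:
  assumes "\<And>as. reduced_word as w \<Longrightarrow> set as \<subseteq> J"
  shows "factor_coeff w g h (filter (\<lambda>x. fst x \<in> J) L) = factor_coeff w g h L"
proof (induction L arbitrary: g)
  case (Cons x L)
  have "factor_coeff w (g @ [fst x]) h L = 0" if "fst x \<notin> J"
  proof (rule factor_coeff_eq_0)
    show "\<not> reduced_word ((g @ [fst x]) @ as @ h) w" for as
      using assms[of "(g @ [fst x]) @ as @ h"] that by auto
  qed
  then show ?case using Cons.IH by simp
qed simp

text \<open>The coefficient at \<open>w\<close> vanishes on the left ideal generated by the \<open>u\<^sub>k\<close> for which \<open>k\<close> is not a descent of
  \<open>w\<close>.\<close>

lemma factor_coeff_drop_right:
  assumes "\<And>as k. k \<in> fst ` set M \<Longrightarrow> \<not> reduced_word (as @ [k]) w"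
  shows "factor_coeff w g [] (L @ M) = factor_coeff w g [] L"
  using assms
proof (induction M rule: rev_induct)
  case (snoc x M)
  have "factor_coeff w g [fst x] (L @ M) = 0"
    by (rule factor_coeff_eq_0) (use snoc.prems[of "fst x"] in \<open>simp flip: append_assoc\<close>)
  moreover have "factor_coeff w g [] (L @ M) = factor_coeff w g [] L" using snoc by simp
  ultimately show ?case using factor_coeff_snoc[of w g "[]" "L @ M" "fst x" "snd x"] by simp
qed simp

definition reduced_pairs :: "(int \<Rightarrow> int) \<Rightarrow> ((int \<Rightarrow> int) \<times> (int \<Rightarrow> int)) set" where
  "reduced_pairs w = {(u, v). u \<in> WD_inf \<and> v \<in> WD_inf \<and> u \<circ> v = w \<and> len u + len v = len w}"

lemma reduced_pairs_WD:
  assumes "(u, v) \<in> reduced_pairs w" "w \<in> WD n" "2 \<le> n"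
  shows "u \<in> WD n" "v \<in> WD n"
proof -
  have "u \<in> WD_inf" "v \<in> WD_inf" using assms(1) by (auto simp: reduced_pairs_def)
  then obtain as bs where a: "word_perm as = u" "length as = len u" and b: "word_perm bs = v" "length bs = len v"
    by (meson WD_inf_word)
  then have "reduced_word (as @ bs) w" using assms(1) by (simp add: reduced_word_def reduced_pairs_def)
  from reduced_word_letters_less[OF assms(2,3) this]
  show "u \<in> WD n" "v \<in> WD n" using a b word_perm_in_WD[OF _ assms(3)] by auto
qed

lemma finite_reduced_pairs:
  assumes "w \<in> WD_inf"
  shows "finite (reduced_pairs w)"
proof -
  obtain n where n: "2 \<le> n" "w \<in> WD n" using assms by (rule WD_infE)
  have "reduced_pairs w \<subseteq> WD n \<times> WD n"
  proof (rule subrelI)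
    fix u v assume "(u, v) \<in> reduced_pairs w"
    from reduced_pairs_WD[OF this n(2,1)] show "(u, v) \<in> WD n \<times> WD n" by simp
  qed
  then show ?thesis by (rule finite_subset) (simp add: finite_WD)
qed

text \<open>At most one pair contributes, the one formed by the permutations of the two words.\<close>

lemma factor_coeff_split_words:
  assumes "w \<in> WD_inf"
  shows "of_bool (reduced_word (g @ h) w) =
    (\<Sum>(u, v)\<in>reduced_pairs w. of_bool (reduced_word g u) * of_bool (reduced_word h v) :: 'r::comm_ring_1)"
proof -
  let ?p = "(word_perm g, word_perm h)"
  have *: "p = ?p \<and> reduced_word (g @ h) w"
    if "p \<in> reduced_pairs w" "reduced_word g (fst p)" "reduced_word h (snd p)" for p
    using that by (auto simp: reduced_word_def reduced_pairs_def)
  have "(\<Sum>(u, v)\<in>reduced_pairs w. of_bool (reduced_word g u) * of_bool (reduced_word h v) :: 'r)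
    = (\<Sum>p\<in>reduced_pairs w. if p = ?p then of_bool (reduced_word (g @ h) w) else 0)"
  proof (intro sum.cong refl)
    fix p assume p: "p \<in> reduced_pairs w"
    have "reduced_word g (fst p) \<and> reduced_word h (snd p)" if "p = ?p" "reduced_word (g @ h) w"
      using that p len_le[of g "fst p"] len_le[of h "snd p"]
      by (auto simp: reduced_word_def reduced_pairs_def)
    with *[OF p] have "reduced_word g (fst p) \<and> reduced_word h (snd p) \<longleftrightarrow> p = ?p \<and> reduced_word (g @ h) w"
      by blast
    then show "(case p of (u, v) \<Rightarrow> of_bool (reduced_word g u) * of_bool (reduced_word h v))
      = (if p = ?p then of_bool (reduced_word (g @ h) w) else 0 :: 'r)"
      unfolding case_prod_beta of_bool_conj[symmetric] by simp
  qed
  also have "\<dots> = (if ?p \<in> reduced_pairs w then of_bool (reduced_word (g @ h) w) else 0)"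
    using finite_reduced_pairs[OF assms] by (rule sum.delta)
  also have "\<dots> = of_bool (reduced_word (g @ h) w)"
  proof -
    have "?p \<in> reduced_pairs w" if r: "reduced_word (g @ h) w"
    proof -
      have w: "word_perm g \<circ> word_perm h = w" and l: "length g + length h = len w"
        using r by (auto simp: reduced_word_def)
      obtain g' h' where gh': "word_perm g' = word_perm g" "length g' = len (word_perm g)"
          "word_perm h' = word_perm h" "length h' = len (word_perm h)"
        by (meson WD_inf_word word_perm_in_WD_inf)
      then have "word_perm (g' @ h') = w" using w by simp
      from len_le[OF this] show ?thesis
        using w l gh' len_le[OF refl, of g] len_le[OF refl, of h]
        by (auto simp: reduced_pairs_def word_perm_in_WD_inf)
    qed
    then show ?thesis by auto
  qed
  finally show ?thesis by simp
qed

text \<open>The structure constants of the nilCoxeter algebra: \<open>u\<^sub>u u\<^sub>v\<close> is \<open>u\<^sub>w\<close> if the pair is a reduced factorization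
  of \<open>w\<close>, and otherwise has no component along \<open>u\<^sub>w\<close>.\<close>

theorem factor_coeff_append:
  assumes "w \<in> WD_inf"
  shows "factor_coeff w g h (L @ M) = (\<Sum>(u, v)\<in>reduced_pairs w. factor_coeff u g [] L * factor_coeff v [] h M)"
proof (induction L arbitrary: g)
  case Nil
  show ?case
  proof (induction M arbitrary: h rule: rev_induct)
    case Nil
    show ?case using factor_coeff_split_words[OF assms, of g h] by simp
  next
    case (snoc x M)
    obtain k t where x: "x = (k, t)" by (cases x)
    show ?case
      using snoc.IH[of h] snoc.IH[of "k # h"]
      by (simp add: x factor_coeff_snoc case_prod_beta sum.distrib sum_distrib_left algebra_simps)
  qed
next
  case (Cons x L)
  show ?case using Cons.IH[of g] Cons.IH[of "g @ [fst x]"]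
    by (simp add: case_prod_beta sum.distrib sum_distrib_left algebra_simps)
qed

lemma foldr_comp_word:
  assumes "set us \<subseteq> WD_inf"
  shows "\<exists>as. word_perm as = foldr (\<circ>) us id \<and> length as = sum_list (map len us)"
  using assms
proof (induction us)
  case Nil
  show ?case by (rule exI[of _ "[]"]) simp
next
  case (Cons u us)
  then have "\<exists>as. word_perm as = foldr (\<circ>) us id \<and> length as = sum_list (map len us)" by (intro Cons.IH) simp
  then obtain as where as: "word_perm as = foldr (\<circ>) us id" "length as = sum_list (map len us)" by blast
  obtain bs where bs: "word_perm bs = u" "length bs = len u" using Cons.prems by (auto elim: WD_inf_word)
  have "word_perm (bs @ as) = foldr (\<circ>) (u # us) id"
    by (simp only: word_perm_append as bs foldr.simps o_apply)
  moreover have "length (bs @ as) = sum_list (map len (u # us))" using as bs by simp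
  ultimately show ?case by blast
qed

text \<open>Subadditivity of the length forces the remaining factors to be a reduced factorization of their own
  product.\<close>

lemma reduced_factorization_Cons:
  "reduced_factorization (u # us) w \<longleftrightarrow> (\<exists>v. (u, v) \<in> reduced_pairs w \<and> reduced_factorization us v)"
proof
  assume r: "reduced_factorization (u # us) w"
  let ?v = "foldr (\<circ>) us id"
  have u: "u \<in> WD_inf" "set us \<subseteq> WD_inf" "u \<circ> ?v = w" "len u + sum_list (map len us) = len w"
    using r by (auto simp: reduced_factorization_def)
  obtain as where as: "word_perm as = ?v" "length as = sum_list (map len us)"
    using foldr_comp_word[OF u(2)] by blast
  have v: "?v \<in> WD_inf" using word_perm_in_WD_inf[of as] as by simp
  obtain bs cs where b: "word_perm bs = u" "length bs = len u" and c: "word_perm cs = ?v" "length cs = len ?v"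
    using u(1) v by (meson WD_inf_word)
  have "len w \<le> len u + len ?v" using len_le[of "bs @ cs" w] b c u(3) by simp
  then have "len ?v = sum_list (map len us)" using len_le[OF as(1)] as(2) u(4) by simp
  then show "\<exists>v. (u, v) \<in> reduced_pairs w \<and> reduced_factorization us v"
    using u v by (intro exI[of _ ?v]) (auto simp: reduced_pairs_def reduced_factorization_def)
qed (auto simp: reduced_pairs_def reduced_factorization_def)

definition reduced_factorizations :: "nat \<Rightarrow> (int \<Rightarrow> int) \<Rightarrow> (int \<Rightarrow> int) list set" where
  "reduced_factorizations m w = {us. length us = m \<and> reduced_factorization us w}"

lemma reduced_factorization_WD:
  assumes "reduced_factorization us w" "w \<in> WD n" "2 \<le> n"
  shows "set us \<subseteq> WD n"
  using assms(1,2)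
proof (induction us arbitrary: w)
  case (Cons u us)
  then obtain v where "(u, v) \<in> reduced_pairs w" "reduced_factorization us v"
    by (auto simp: reduced_factorization_Cons)
  then show ?case using reduced_pairs_WD[OF _ Cons.prems(2) assms(3)] Cons.IH[of v] by auto
qed simp

lemma finite_reduced_factorizations:
  assumes "w \<in> WD_inf"
  shows "finite (reduced_factorizations m w)"
proof -
  obtain n where n: "2 \<le> n" "w \<in> WD n" using assms by (rule WD_infE)
  have "reduced_factorizations m w \<subseteq> {us. set us \<subseteq> WD n \<and> length us = m}"
    using reduced_factorization_WD[OF _ n(2,1)] by (auto simp: reduced_factorizations_def)
  then show ?thesis by (rule finite_subset) (simp add: finite_WD finite_lists_length_eq)
qed

theorem factor_coeff_concat:
  assumes "w \<in> WD_inf"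
  shows "factor_coeff w [] [] (concat Ls) =
    (\<Sum>us\<in>reduced_factorizations (length Ls) w. \<Prod>i<length Ls. factor_coeff (us ! i) [] [] (Ls ! i))"
  using assms
proof (induction Ls arbitrary: w)
  case Nil
  have "reduced_factorizations 0 w = (if reduced_word [] w then {[]} else {})"
    by (auto simp: reduced_factorizations_def reduced_factorization_def reduced_word_def)
  then show ?case by simp
next
  case (Cons L Ls)
  let ?m = "length Ls"
  let ?f = "\<lambda>us. \<Prod>i<?m. factor_coeff (us ! i) [] [] (Ls ! i)"
  have v: "v \<in> WD_inf" if "(u, v) \<in> reduced_pairs w" for u v
    using that by (simp add: reduced_pairs_def)
  have "factor_coeff w [] [] (concat (L # Ls)) = (\<Sum>(u, v)\<in>reduced_pairs w. factor_coeff u [] [] L * factor_coeff v [] [] (concat Ls))"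
    using factor_coeff_append[OF Cons.prems] by simp
  also have "\<dots> = (\<Sum>p\<in>reduced_pairs w. \<Sum>us\<in>reduced_factorizations ?m (snd p). factor_coeff (fst p) [] [] L * ?f us)"
    using Cons.IH[OF v] by (intro sum.cong) (auto simp: sum_distrib_left)
  also have "\<dots> = (\<Sum>(p, us)\<in>Sigma (reduced_pairs w) (\<lambda>p. reduced_factorizations ?m (snd p)). factor_coeff (fst p) [] [] L * ?f us)"
    using finite_reduced_pairs[OF Cons.prems] finite_reduced_factorizations[OF v]
    by (intro sum.Sigma) auto
  also have "\<dots> = (\<Sum>us\<in>reduced_factorizations (Suc ?m) w. factor_coeff (hd us) [] [] L * ?f (tl us))"
  proof (rule sum.reindex_bij_witness[of _ "\<lambda>us. ((hd us, foldr (\<circ>) (tl us) id), tl us)" "\<lambda>(p, us). fst p # us"])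
    fix us assume "us \<in> reduced_factorizations (Suc ?m) w"
    then obtain u us' where us: "us = u # us'" "length us' = ?m" "reduced_factorization (u # us') w"
      by (cases us) (auto simp: reduced_factorizations_def)
    then obtain v where "(u, v) \<in> reduced_pairs w" "reduced_factorization us' v"
      by (auto simp: reduced_factorization_Cons)
    moreover from this have "foldr (\<circ>) us' id = v" by (simp add: reduced_factorization_def)
    ultimately show "((hd us, foldr (\<circ>) (tl us) id), tl us)
        \<in> Sigma (reduced_pairs w) (\<lambda>p. reduced_factorizations ?m (snd p))"
      "(case ((hd us, foldr (\<circ>) (tl us) id), tl us) of (p, us) \<Rightarrow> fst p # us) = us"
      using us by (simp_all add: reduced_factorizations_def)
  next
    fix x assume "x \<in> Sigma (reduced_pairs w) (\<lambda>p. reduced_factorizations ?m (snd p))"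
    then obtain u v us where x: "x = ((u, v), us)" "(u, v) \<in> reduced_pairs w" "length us = ?m"
        "reduced_factorization us v"
      by (auto simp: reduced_factorizations_def)
    moreover from this have "foldr (\<circ>) us id = v" by (simp add: reduced_factorization_def)
    ultimately show "((hd (case x of (p, us) \<Rightarrow> fst p # us), foldr (\<circ>) (tl (case x of (p, us) \<Rightarrow> fst p # us)) id),
        tl (case x of (p, us) \<Rightarrow> fst p # us)) = x"
      "(case x of (p, us) \<Rightarrow> fst p # us) \<in> reduced_factorizations (Suc ?m) w"
      "factor_coeff (hd (case x of (p, us) \<Rightarrow> fst p # us)) [] [] L * ?f (tl (case x of (p, us) \<Rightarrow> fst p # us))
        = (case x of (p, us) \<Rightarrow> factor_coeff (fst p) [] [] L * ?f us)"
      by (auto simp: reduced_factorizations_def reduced_factorization_Cons)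
  qed
  also have "\<dots> = (\<Sum>us\<in>reduced_factorizations (length (L # Ls)) w. \<Prod>i<length (L # Ls). factor_coeff (us ! i) [] [] ((L # Ls) ! i))"
  proof (intro sum.cong)
    fix us assume "us \<in> reduced_factorizations (length (L # Ls)) w"
    then obtain u us' where "us = u # us'" by (cases us) (auto simp: reduced_factorizations_def)
    then show "factor_coeff (hd us) [] [] L * ?f (tl us) = (\<Prod>i<length (L # Ls). factor_coeff (us ! i) [] [] ((L # Ls) ! i))"
      by (simp add: prod.lessThan_Suc_shift del: prod.lessThan_Suc)
  qed simp
  finally show ?case .
qed

section \<open>Lowering the rows within a block\<close>

text \<open>Lowering the start of a row from \<open>i\<close> to \<open>l + 1\<close> inserts factors with letters below \<open>i\<close>.  If the rows are treated from left
  to right, the rows to the right of the current one start at \<open>i + 1\<close> or later, so the inserted factors commute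
  with them and reach the right end, where they have no effect on the coefficient at \<open>w\<close> because their
  letters are not descents of \<open>w\<close>.\<close>

lemma replace_rows_right:
  assumes le: "l \<le> e" "e \<le> m"
    and nd: "\<And>k as. l < k \<Longrightarrow> k < e \<Longrightarrow> \<not> reduced_word (as @ [k]) w"
  shows "factor_coeff w [] [] (X @ concat (map (\<lambda>i. rev (row n i (y i))) [Suc l..<Suc m])) =
    factor_coeff w [] [] (X @ concat (map (\<lambda>i. rev (row n (Suc l) (y i))) [Suc l..<Suc e])
      @ concat (map (\<lambda>i. rev (row n i (y i))) [Suc e..<Suc m]))"
  using le nd
proof (induction e rule: dec_induct)
  case base
  show ?case by simp
next
  case (step e)
  let ?Y = "X @ concat (map (\<lambda>i. rev (row n (Suc l) (y i))) [Suc l..<Suc e])"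
  let ?T = "concat (map (\<lambda>i. rev (row n i (y i))) [Suc (Suc e)..<Suc m])"
  \<comment> \<open>the factors by which the lowered row exceeds the original one; rows starting at \<open>n\<close> or later are empty\<close>
  let ?M = "map (\<lambda>k. (k, y (Suc e))) [Suc l..<min n (Suc e)]"
  have "[Suc l..<n] = [Suc l..<min n (Suc e)] @ [Suc e..<n]"
    using step.hyps(1) upt_add_eq_append[of "Suc l" "Suc e" "n - Suc e"]
    by (cases "Suc e \<le> n") (simp_all add: min_def)
  then have row: "rev (row n (Suc l) (y (Suc e))) = rev (row n (Suc e) (y (Suc e))) @ rev ?M"
    by (simp add: row_def)
  have comm: "factor_equiv (?T @ rev ?M) (rev ?M @ ?T)"
  proof (rule factor_equiv_commute_lists)
    fix i k assume "i \<in> fst ` set (rev ?M)" "k \<in> fst ` set ?T"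
    then have "0 < i" "i \<le> e" "Suc (Suc e) \<le> k" by (auto simp: row_def)
    then show "commuting i k" by (intro commuting_far) auto
  qed
  have "factor_coeff w [] [] (X @ concat (map (\<lambda>i. rev (row n i (y i))) [Suc l..<Suc m])) =
      factor_coeff w [] [] (?Y @ concat (map (\<lambda>i. rev (row n i (y i))) [Suc e..<Suc m]))"
    using step.IH step.prems by simp
  also have "\<dots> = factor_coeff w [] [] (?Y @ rev (row n (Suc e) (y (Suc e))) @ ?T)"
    using step.prems(1) by (simp add: upt_conv_Cons del: upt_Suc)
  also have "\<dots> = factor_coeff w [] [] ((?Y @ rev (row n (Suc e) (y (Suc e))) @ ?T) @ rev ?M)"
    by (rule factor_coeff_drop_right[symmetric]) (use step.prems(2) in auto)
  also have "\<dots> = factor_coeff w [] [] ((?Y @ rev (row n (Suc e) (y (Suc e)))) @ (rev ?M @ ?T) @ [])"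
    using factor_equiv_factor_coeff[OF comm, of w "[]" "[]" "?Y @ rev (row n (Suc e) (y (Suc e)))" "[]"] by simp
  also have "\<dots> = factor_coeff w [] [] (?Y @ rev (row n (Suc l) (y (Suc e))) @ ?T)"
    unfolding row by simp
  finally show ?case using step.hyps(1) by simp
qed


section \<open>Limits of coefficients\<close>

lemma mps_nth_add: "mps_nth (f + g) m = mps_nth f m + mps_nth g m"
  by (simp add: plus_mps_def)

lemma mps_nth_diff: "mps_nth (f - g) m = mps_nth f m - mps_nth g m"
  by (simp add: minus_mps_def)

lemma mps_nth_zero: "mps_nth 0 m = 0"
  by (simp add: zero_mps_def)

lemma mps_nth_mult: "mps_nth (f * g) m = (\<Sum>p\<in>mon_splits m. mps_nth f (fst p) * mps_nth g (snd p))"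
  by (simp add: times_mps_def)

definition mps_tendsto :: "(nat \<Rightarrow> 'v mps) \<Rightarrow> 'v mps \<Rightarrow> bool" where
  "mps_tendsto F L \<longleftrightarrow> (\<forall>m. eventually (\<lambda>N. mps_nth (F N) m = mps_nth L m) sequentially)"

lemma mps_lim_eqI:
  assumes "mps_tendsto F L"
  shows "mps_lim F = L"
proof (rule mps_eqI)
  fix m
  have "(\<lambda>N. mps_nth (F N) m) \<longlonglongrightarrow> mps_nth L m"
    using assms by (intro tendsto_eventually) (simp add: mps_tendsto_def)
  then show "mps_nth (mps_lim F) m = mps_nth L m" by (simp add: mps_lim_def limI)
qed

lemma mps_tendsto_const: "mps_tendsto (\<lambda>_. L) L"
  by (simp add: mps_tendsto_def)

lemma mps_tendsto_add:
  assumes "mps_tendsto F L" "mps_tendsto G M"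
  shows "mps_tendsto (\<lambda>N. F N + G N) (L + M)"
  unfolding mps_tendsto_def
proof
  fix m
  have "eventually (\<lambda>N. mps_nth (F N) m = mps_nth L m) sequentially"
    "eventually (\<lambda>N. mps_nth (G N) m = mps_nth M m) sequentially"
    using assms by (simp_all add: mps_tendsto_def)
  then show "eventually (\<lambda>N. mps_nth (F N + G N) m = mps_nth (L + M) m) sequentially"
    by eventually_elim (simp add: mps_nth_add)
qed

lemma mps_tendsto_mult:
  assumes "mps_tendsto F L" "mps_tendsto G M"
  shows "mps_tendsto (\<lambda>N. F N * G N) (L * M)"
  unfolding mps_tendsto_def
proof
  fix m
  have "eventually (\<lambda>N. \<forall>p\<in>mon_splits m. mps_nth (F N) (fst p) = mps_nth L (fst p)
      \<and> mps_nth (G N) (snd p) = mps_nth M (snd p)) sequentially"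
    using assms by (intro eventually_ball_finite finite_mon_splits ballI eventually_conj)
      (simp_all add: mps_tendsto_def)
  then show "eventually (\<lambda>N. mps_nth (F N * G N) m = mps_nth (L * M) m) sequentially"
    by eventually_elim (simp add: mps_nth_mult)
qed

lemma mps_tendsto_sum:
  "(\<And>i. i \<in> A \<Longrightarrow> mps_tendsto (F i) (L i)) \<Longrightarrow> mps_tendsto (\<lambda>N. \<Sum>i\<in>A. F i N) (\<Sum>i\<in>A. L i)"
  by (induction A rule: infinite_finite_induct) (simp_all add: mps_tendsto_const mps_tendsto_add)

lemma mps_tendsto_eventually_cong:
  assumes "mps_tendsto F L" "\<And>N. K \<le> N \<Longrightarrow> F N = G N"
  shows "mps_tendsto G L"
  unfolding mps_tendsto_def
proof
  fix m
  have "eventually (\<lambda>N. mps_nth (F N) m = mps_nth L m) sequentially"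
    using assms(1) by (simp add: mps_tendsto_def)
  then show "eventually (\<lambda>N. mps_nth (G N) m = mps_nth L m) sequentially"
    using eventually_ge_at_top[of K] by eventually_elim (simp add: assms(2))
qed

text \<open>For a fixed monomial \<open>m\<close> this describes an ideal of power series, those without terms in the divisors of \<open>m\<close>.
  It contains every variable that does not occur in \<open>m\<close>; modulo this ideal the infinite product over the
  variables \<open>x\<close> stops changing.\<close>

definition vanishes_below :: "('v \<Rightarrow>\<^sub>0 nat) \<Rightarrow> 'v mps \<Rightarrow> bool" where
  "vanishes_below m f \<longleftrightarrow> (\<forall>a b. a + b = m \<longrightarrow> mps_nth f a = 0)"

lemma vanishes_below_zero: "vanishes_below m 0"
  by (simp add: vanishes_below_def mps_nth_zero)

lemma vanishes_below_add: "vanishes_below m f \<Longrightarrow> vanishes_below m g \<Longrightarrow> vanishes_below m (f + g)"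
  by (simp add: vanishes_below_def mps_nth_add)

lemma vanishes_below_mult:
  assumes "vanishes_below m f"
  shows "vanishes_below m (f * g)"
  unfolding vanishes_below_def
proof (intro allI impI)
  fix a b assume ab: "a + b = m"
  show "mps_nth (f * g) a = 0"
    unfolding mps_nth_mult
  proof (intro sum.neutral ballI)
    fix p assume "p \<in> mon_splits a"
    then have "fst p + (snd p + b) = m" using ab by (auto simp: mon_splits_def add.assoc)
    then have "mps_nth f (fst p) = 0" using assms by (simp only: vanishes_below_def)
    then show "mps_nth f (fst p) * mps_nth g (snd p) = 0" by simp
  qed
qed

lemma vanishes_below_var:
  assumes "v \<notin> Poly_Mapping.keys m"
  shows "vanishes_below m (mps_var v)"
  unfolding vanishes_below_def
proof (intro allI impI)
  fix a b :: "'a \<Rightarrow>\<^sub>0 nat" assume "a + b = m"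
  then have "Poly_Mapping.lookup a v + Poly_Mapping.lookup b v = 0"
    using assms by (simp add: in_keys_iff flip: lookup_add)
  then show "mps_nth (mps_var v) a = 0" by (auto simp: mps_var_def)
qed

lemma factor_coeff_insert_vanishing:
  assumes "\<And>t. t \<in> snd ` set M \<Longrightarrow> vanishes_below m t"
  shows "vanishes_below m (factor_coeff w g h (L @ M @ R) - factor_coeff w g h (L @ R))"
proof (induction L arbitrary: g)
  case Nil
  show ?case
    using assms
  proof (induction M arbitrary: g)
    case Nil
    show ?case by (simp add: vanishes_below_zero)
  next
    case (Cons x M)
    have "vanishes_below m ((factor_coeff w g h (M @ R) - factor_coeff w g h R) + snd x * factor_coeff w (g @ [fst x]) h (M @ R))"
      using Cons by (intro vanishes_below_add vanishes_below_mult) auto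
    then show ?case by (simp add: algebra_simps)
  qed
next
  case (Cons x L)
  have "vanishes_below m ((factor_coeff w g h (L @ M @ R) - factor_coeff w g h (L @ R))
     + (factor_coeff w (g @ [fst x]) h (L @ M @ R) - factor_coeff w (g @ [fst x]) h (L @ R)) * snd x)"
    using Cons by (intro vanishes_below_add vanishes_below_mult) auto
  then show ?case by (simp add: algebra_simps)
qed

definition D_row :: "nat \<Rightarrow> 'r::comm_ring_1 \<Rightarrow> (nat \<times> 'r) list" where
  "D_row n t = rev (row n 2 t) @ [(1, t), (0, t)] @ row n 2 t"

definition D_rows :: "nat \<Rightarrow> (nat \<Rightarrow> 'r::comm_ring_1) \<Rightarrow> nat \<Rightarrow> (nat \<times> 'r) list" where
  "D_rows n x N = concat (map (\<lambda>k. D_row n (x k)) [1..<Suc N])"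

lemma snd_set_D_row: "snd ` set (D_row n t) = {t}"
  by (auto simp: D_row_def row_def)

text \<open>A monomial involves finitely many variables, and a factor whose variable does not occur in it does
  not change its coefficient.\<close>

lemma mps_tendsto_factor_coeff_D_rows:
  "\<exists>L. mps_tendsto (\<lambda>N. factor_coeff w g h (A @ D_rows n var_X N @ B)) L"
proof -
  let ?F = "\<lambda>N. factor_coeff w g h (A @ D_rows n var_X N @ B)"
  have "\<exists>b. \<forall>k. VX k \<in> Poly_Mapping.keys m \<longrightarrow> k \<le> b" for m :: "var \<Rightarrow>\<^sub>0 nat"
  proof -
    have "finite (VX -` Poly_Mapping.keys m)" by (rule finite_vimageI) (auto simp: inj_def)
    then show ?thesis by (auto simp: finite_nat_set_iff_bounded_le)
  qed
  then have "\<forall>m :: var \<Rightarrow>\<^sub>0 nat. \<exists>b. \<forall>k. VX k \<in> Poly_Mapping.keys m \<longrightarrow> k \<le> b" by blast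
  then have "\<exists>b. \<forall>m :: var \<Rightarrow>\<^sub>0 nat. \<forall>k. VX k \<in> Poly_Mapping.keys m \<longrightarrow> k \<le> b m" by (rule choice)
  then obtain b where b: "\<And>(m :: var \<Rightarrow>\<^sub>0 nat) k. VX k \<in> Poly_Mapping.keys m \<Longrightarrow> k \<le> b m" by blast
  have stable: "mps_nth (?F N) m = mps_nth (?F (b m)) m" if "b m \<le> N" for N m
    using that
  proof (induction N rule: dec_induct)
    case base
    show ?case ..
  next
    case (step N)
    have "VX (Suc N) \<notin> Poly_Mapping.keys m" using b[of "Suc N" m] step.hyps(1) by auto
    then have "vanishes_below m (factor_coeff w g h ((A @ D_rows n var_X N) @ D_row n (var_X (Suc N)) @ B)
        - factor_coeff w g h ((A @ D_rows n var_X N) @ B))"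
      by (intro factor_coeff_insert_vanishing) (simp add: snd_set_D_row vanishes_below_var)
    then have "mps_nth (factor_coeff w g h ((A @ D_rows n var_X N) @ D_row n (var_X (Suc N)) @ B)
        - factor_coeff w g h ((A @ D_rows n var_X N) @ B)) m = 0"
      unfolding vanishes_below_def by (metis add.right_neutral)
    then have "mps_nth (?F (Suc N)) m = mps_nth (?F N) m"
      by (simp add: mps_nth_diff D_rows_def)
    then show ?case using step.IH by simp
  qed
  have "mps_tendsto ?F (Abs_mps (\<lambda>m. mps_nth (?F (b m)) m))"
    unfolding mps_tendsto_def eventually_sequentially mps_nth_Abs using stable by blast
  then show ?thesis ..
qed

section \<open>Stanley functions in terms of factor lists\<close>

lemma rank_WD:
  assumes "w \<in> WD_inf"
  shows "2 \<le> rank w" "w \<in> WD (rank w)"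
proof -
  obtain n where "2 \<le> n" "w \<in> WD n" using assms by (rule WD_infE)
  then have "2 \<le> rank w \<and> w \<in> WD (rank w)"
    unfolding rank_def by (intro LeastI[of "\<lambda>n. 2 \<le> n \<and> w \<in> WD n"]) auto
  then show "2 \<le> rank w" "w \<in> WD (rank w)" by auto
qed

lemma rank_le: "2 \<le> n \<Longrightarrow> w \<in> WD n \<Longrightarrow> rank w \<le> n"
  unfolding rank_def by (rule Least_le) simp

lemma factor_prod_append: "factor_prod (L @ M) = factor_prod L * factor_prod M"
  by (simp add: factor_prod_def)

lemma prod_list_factor_prod:
  "prod_list (map (\<lambda>k. factor_prod (f k)) ks) = factor_prod (concat (map f ks))"
  by (induction ks) (simp_all add: factor_prod_append, simp add: factor_prod_def)

lemma A_ser_factor_prod: "A_ser n i t = factor_prod (rev (row n i t))"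
  by (simp add: A_ser_def factor_prod_def row_def rev_map o_def)

lemma At_ser_factor_prod: "At_ser n i t = factor_prod (row n i (- t))"
  by (simp add: At_ser_def factor_prod_def row_def o_def)

lemma D_ser_factor_prod: "D_ser n t = factor_prod (D_row n t)"
  by (simp add: D_ser_def factor_prod_def D_row_def row_def rev_map o_def)

lemmas ser_factor_prod = ser_prod_def A_ser_factor_prod At_ser_factor_prod D_ser_factor_prod
  prod_list_factor_prod factor_prod_append[symmetric] D_rows_def[symmetric]

text \<open>With a sequence \<open>z\<close> that vanishes beyond \<open>K\<close>, these are the finite forms of the infinite products in the
  definitions of the Stanley functions.\<close>

definition rows_up :: "nat \<Rightarrow> nat \<Rightarrow> (nat \<Rightarrow> 'r::comm_ring_1) \<Rightarrow> nat \<Rightarrow> (nat \<times> 'r) list" where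
  "rows_up n i z K = concat (map (\<lambda>k. row n i (z k)) [1..<Suc K])"

definition rows_down :: "nat \<Rightarrow> nat \<Rightarrow> (nat \<Rightarrow> 'r::comm_ring_1) \<Rightarrow> nat \<Rightarrow> (nat \<times> 'r) list" where
  "rows_down n i y K = concat (map (\<lambda>k. rev (row n i (y k))) [1..<Suc K])"

lemma fst_set_rows: "fst ` set (rows_up n i z K) \<subseteq> {i..<n}" "fst ` set (rows_down n i z K) \<subseteq> {i..<n}"
  by (auto simp: rows_up_def rows_down_def row_def)

lemma fst_set_D_rows: "2 \<le> n \<Longrightarrow> fst ` set (D_rows n x N) \<subseteq> {..<n}"
  by (auto simp: D_rows_def D_row_def row_def)

lemma filter_row:
  assumes "J \<inter> {i..<n} = {j..<r}"
  shows "filter (\<lambda>x. fst x \<in> J) (row n i t) = row r j t"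
proof -
  have "filter (\<lambda>k. k \<in> J) [i..<n] = [j..<r]"
  proof (rule sorted_distinct_set_unique)
    have "set (filter (\<lambda>k. k \<in> J) [i..<n]) = J \<inter> {i..<n}" by auto
    then show "set (filter (\<lambda>k. k \<in> J) [i..<n]) = set [j..<r]" by (simp only: assms set_upt)
  qed (simp_all add: sorted_wrt_filter)
  then show ?thesis by (simp add: row_def filter_map o_def)
qed

lemma filter_rev_row:
  assumes "J \<inter> {i..<n} = {j..<r}"
  shows "filter (\<lambda>x. fst x \<in> J) (rev (row n i t)) = rev (row r j t)"
  using filter_row[OF assms] rev_filter by metis

lemma filter_rows:
  assumes "J \<inter> {i..<n} = {j..<r}"
  shows "filter (\<lambda>x. fst x \<in> J) (rows_up n i z K) = rows_up r j z K"
    and "filter (\<lambda>x. fst x \<in> J) (rows_down n i z K) = rows_down r j z K"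
  by (simp_all add: rows_up_def rows_down_def filter_concat filter_row[OF assms] filter_rev_row[OF assms] o_def
      del: upt_Suc)

lemma filter_D_rows:
  fixes x :: "nat \<Rightarrow> 'r::comm_ring_1"
  assumes "2 \<le> r" "r \<le> n"
  shows "filter (\<lambda>x. fst x \<in> {..<r}) (D_rows n x N) = D_rows r x N"
proof -
  have "{..<r} \<inter> {2..<n} = {2..<r}" using assms by auto
  then have "filter (\<lambda>x. fst x \<in> {..<r}) (D_row n t) = D_row r t" for t :: 'r
    using assms(1) unfolding D_row_def by (simp only: filter_append filter_row filter_rev_row) simp
  then show ?thesis by (simp add: D_rows_def filter_concat o_def del: upt_Suc)
qed

lemma factor_equiv_zeros: "(\<And>x. x \<in> set L \<Longrightarrow> snd x = 0) \<Longrightarrow> factor_equiv L []"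
proof (induction L)
  case Nil
  show ?case by (rule factor_equiv_refl)
next
  case (Cons x L)
  have "x = (fst x, 0)" using Cons.prems[of x] by (simp add: prod_eq_iff)
  then have "factor_equiv [x] []" using factor_equiv_zero by metis
  from factor_equiv_append[OF this Cons.IH] Cons.prems show ?case by simp
qed

lemma factor_equiv_rows_truncate:
  assumes "\<And>k. K < k \<Longrightarrow> z k = 0" "K \<le> N"
  shows "factor_equiv (rows_up n i z N) (rows_up n i z K)"
    and "factor_equiv (rows_down n i z N) (rows_down n i z K)"
proof -
  have s: "[1..<Suc N] = [1..<Suc K] @ [Suc K..<Suc N]"
    using upt_add_eq_append[of 1 "Suc K" "N - K"] assms(2) by (simp del: upt_Suc)
  have *: "snd x = 0" if "k \<in> set [Suc K..<Suc N]" "x \<in> set (row n i (z k))" for x k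
    using that assms(1)[of k] by (auto simp: row_def simp del: upt_Suc)
  have "factor_equiv (concat (map (\<lambda>k. row n i (z k)) [Suc K..<Suc N])) []"
  proof (rule factor_equiv_zeros)
    fix x assume "x \<in> set (concat (map (\<lambda>k. row n i (z k)) [Suc K..<Suc N]))"
    then obtain k where "k \<in> set [Suc K..<Suc N]" "x \<in> set (row n i (z k))"
      by (auto simp del: upt_Suc set_upt)
    then show "snd x = 0" by (rule *)
  qed
  moreover have "factor_equiv (concat (map (\<lambda>k. rev (row n i (z k))) [Suc K..<Suc N])) []"
  proof (rule factor_equiv_zeros)
    fix x assume "x \<in> set (concat (map (\<lambda>k. rev (row n i (z k))) [Suc K..<Suc N]))"
    then obtain k where "k \<in> set [Suc K..<Suc N]" "x \<in> set (row n i (z k))"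
      by (auto simp del: upt_Suc set_upt)
    then show "snd x = 0" by (rule *)
  qed
  ultimately have "factor_equiv (concat (map (\<lambda>k. row n i (z k)) [Suc K..<Suc N])) []"
    "factor_equiv (concat (map (\<lambda>k. rev (row n i (z k))) [Suc K..<Suc N])) []" .
  then show "factor_equiv (rows_up n i z N) (rows_up n i z K)"
    "factor_equiv (rows_down n i z N) (rows_down n i z K)"
    using factor_equiv_append[OF factor_equiv_refl] unfolding rows_up_def rows_down_def s
    by (metis append_Nil2 concat_append map_append)+
qed

lemma factor_coeff_change_letters:
  assumes "\<And>as. reduced_word as w \<Longrightarrow> set as \<subseteq> J"
    and "filter (\<lambda>x. fst x \<in> J) L = filter (\<lambda>x. fst x \<in> J) M"
  shows "factor_coeff w g h L = factor_coeff w g h M"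
  using factor_coeff_filter[where J = J and L = L] factor_coeff_filter[where J = J and L = M] assms by metis

lemma letters_fixes_upto:
  assumes "u \<in> fixes_upto l" "reduced_word as u"
  shows "set as \<subseteq> {l<..<rank u}"
proof -
  have "u \<in> WD_inf" using assms(1) by (simp add: fixes_upto_def S_inf_def)
  from reduced_word_letters_less[OF rank_WD(2)[OF this] rank_WD(1)[OF this] assms(2)]
    reduced_word_letters_greater[OF assms]
  show ?thesis by auto
qed

text \<open>Reduced words of an element of the parabolic subgroup only have letters above \<open>l\<close> and below the rank, so
  the rows of its Stanley functions may start at \<open>l + 1\<close> and end at any \<open>n\<close> that is not below the rank.  Rows
  with a zero variable are trivial, so the limit is attained.\<close>

lemma
  assumes u: "u \<in> fixes_upto l" and n: "2 \<le> n" "u \<in> WD n" and K: "\<And>k. K < k \<Longrightarrow> y k = 0"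
  shows stanley_G_eq_factor_coeff: "stanley_G u y = factor_coeff u [] [] (rows_down n (Suc l) y K)"
    and double_stanley_G_eq_factor_coeff:
      "double_stanley_G u (\<lambda>_. 0) y = factor_coeff u [] [] (rows_up n (Suc l) (\<lambda>k. - y k) K)"
proof -
  let ?r = "rank u" and ?y = "\<lambda>k. - y k"
  have ui: "u \<in> WD_inf" using u by (simp add: fixes_upto_def S_inf_def)
  note r = rank_WD[OF ui] and rn = rank_le[OF n]
  have J: "{l<..<?r} \<inter> {1..<?r} = {Suc l..<?r}" "{l<..<?r} \<inter> {Suc l..<n} = {Suc l..<?r}"
    using rn by auto
  have letters: "fst ` set (rows_down ?r 1 y N) \<subseteq> {..<?r}"
     "fst ` set (rows_up ?r 1 ?y N @ rows_down ?r 1 (\<lambda>_. 0) N) \<subseteq> {..<?r}" for N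
    using fst_set_rows[of ?r 1] by fastforce+
  have 1: "stanley_G u y = mps_lim (\<lambda>N. factor_coeff u [] [] (rows_down ?r 1 y N))"
    using nc_coeff_factor_prod[OF r letters(1)]
    by (simp add: stanley_G_def ser_factor_prod Let_def rows_down_def)
  have 2: "double_stanley_G u (\<lambda>_. 0) y = mps_lim (\<lambda>N. factor_coeff u [] [] (rows_up ?r 1 ?y N @ rows_down ?r 1 (\<lambda>_. 0) N))"
    using nc_coeff_factor_prod[OF r letters(2)]
    by (simp add: double_stanley_G_def ser_factor_prod Let_def rows_down_def rows_up_def)
  have e1: "factor_coeff u [] [] (rows_down ?r 1 y N) = factor_coeff u [] [] (rows_down n (Suc l) y K)" if "K \<le> N" for N
  proof -
    have "factor_coeff u [] [] (rows_down ?r 1 y N) = factor_coeff u [] [] (rows_down n (Suc l) y N)"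
    proof (rule factor_coeff_change_letters[OF letters_fixes_upto[OF u]])
      show "filter (\<lambda>x. fst x \<in> {l<..<?r}) (rows_down ?r 1 y N) = filter (\<lambda>x. fst x \<in> {l<..<?r}) (rows_down n (Suc l) y N)"
        unfolding filter_rows[OF J(1)] filter_rows[OF J(2)] ..
    qed
    also have "\<dots> = factor_coeff u [] [] (rows_down n (Suc l) y K)"
      using factor_equiv_factor_coeff[OF factor_equiv_rows_truncate(2)[of K y N n "Suc l"], of u "[]" "[]" "[]" "[]"] K that by simp
    finally show ?thesis .
  qed
  have e2: "factor_coeff u [] [] (rows_up ?r 1 ?y N @ rows_down ?r 1 (\<lambda>_. 0) N) = factor_coeff u [] [] (rows_up n (Suc l) ?y K)"
    if "K \<le> N" for N
  proof -
    have "factor_equiv (rows_down ?r 1 (\<lambda>_. 0 :: 'a mps) N) []"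
      by (rule factor_equiv_zeros) (auto simp: rows_down_def row_def split: if_splits)
    then have "factor_coeff u [] [] (rows_up ?r 1 ?y N @ rows_down ?r 1 (\<lambda>_. 0) N) = factor_coeff u [] [] (rows_up ?r 1 ?y N)"
      using factor_equiv_factor_coeff[of _ _ u "[]" "[]" "rows_up ?r 1 ?y N" "[]"] by fastforce
    also have "\<dots> = factor_coeff u [] [] (rows_up n (Suc l) ?y N)"
    proof (rule factor_coeff_change_letters[OF letters_fixes_upto[OF u]])
      show "filter (\<lambda>x. fst x \<in> {l<..<?r}) (rows_up ?r 1 ?y N) = filter (\<lambda>x. fst x \<in> {l<..<?r}) (rows_up n (Suc l) ?y N)"
        unfolding filter_rows[OF J(1)] filter_rows[OF J(2)] ..
    qed
    also have "\<dots> = factor_coeff u [] [] (rows_up n (Suc l) ?y K)"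
      using factor_equiv_factor_coeff[OF factor_equiv_rows_truncate(1)[of K ?y N n "Suc l"], of u "[]" "[]" "[]" "[]"] K that by simp
    finally show ?thesis .
  qed
  have "mps_tendsto (\<lambda>N. factor_coeff u [] [] (rows_down ?r 1 y N)) (factor_coeff u [] [] (rows_down n (Suc l) y K))"
    by (rule mps_tendsto_eventually_cong[OF mps_tendsto_const, of K]) (simp only: e1)
  then show "stanley_G u y = factor_coeff u [] [] (rows_down n (Suc l) y K)"
    unfolding 1 by (rule mps_lim_eqI)
  have "mps_tendsto (\<lambda>N. factor_coeff u [] [] (rows_up ?r 1 ?y N @ rows_down ?r 1 (\<lambda>_. 0) N)) (factor_coeff u [] [] (rows_up n (Suc l) ?y K))"
    by (rule mps_tendsto_eventually_cong[OF mps_tendsto_const, of K]) (simp only: e2)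
  then show "double_stanley_G u (\<lambda>_. 0) y = factor_coeff u [] [] (rows_up n (Suc l) ?y K)"
    unfolding 2 by (rule mps_lim_eqI)
qed

text \<open>The mixed Stanley function is a limit over the variables \<open>x\<close> only: the other two sets of variables are
  finite, and the rank may be raised from that of \<open>u\<close> to \<open>n\<close>.\<close>

lemma mixed_stanley_I_tendsto:
  assumes n: "2 \<le> n" "u \<in> WD n" and K: "\<And>k. Ky < k \<Longrightarrow> y k = 0" "\<And>k. Kz < k \<Longrightarrow> z k = 0"
  shows "mps_tendsto (\<lambda>N. factor_coeff u [] [] (rows_up n 1 (\<lambda>k. - z k) Kz @ D_rows n var_X N @ rows_down n 1 y Ky))
    (mixed_stanley_I u var_X y z)"
proof -
  let ?r = "rank u" and ?z = "\<lambda>k. - z k"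
  let ?F = "\<lambda>N. factor_coeff u [] [] (rows_up ?r 1 ?z N @ D_rows ?r var_X N @ rows_down ?r 1 y N)"
  let ?G = "\<lambda>N. factor_coeff u [] [] (rows_up n 1 ?z Kz @ D_rows n var_X N @ rows_down n 1 y Ky)"
  have ui: "u \<in> WD_inf" using n WD_inf_I by blast
  note r = rank_WD[OF ui] and rn = rank_le[OF n]
  have letters: "fst ` set (rows_up ?r 1 ?z N @ D_rows ?r var_X N @ rows_down ?r 1 y N) \<subseteq> {..<?r}" for N
    using fst_set_rows[of ?r 1] fst_set_D_rows[OF r(1)] by fastforce
  have 1: "mixed_stanley_I u var_X y z = mps_lim ?F"
    using nc_coeff_factor_prod[OF r letters]
    by (simp add: mixed_stanley_I_def ser_factor_prod Let_def rows_down_def rows_up_def D_rows_def)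
  have J: "{..<?r} \<inter> {1..<?r} = {1..<?r}" "{..<?r} \<inter> {1..<n} = {1..<?r}"
    using rn by auto
  have eq: "?G N = ?F N" if N: "max Ky Kz \<le> N" for N
  proof -
    have e: "factor_equiv (rows_up ?r 1 ?z N @ D_rows ?r var_X N @ rows_down ?r 1 y N)
         (rows_up ?r 1 ?z Kz @ D_rows ?r var_X N @ rows_down ?r 1 y Ky)"
      using N K by (intro factor_equiv_append factor_equiv_refl factor_equiv_rows_truncate) auto
    have "?F N = factor_coeff u [] [] (rows_up ?r 1 ?z Kz @ D_rows ?r var_X N @ rows_down ?r 1 y Ky)"
      using factor_equiv_factor_coeff[OF e, of u "[]" "[]" "[]" "[]"] by simp
    also have "\<dots> = ?G N"
    proof (rule factor_coeff_change_letters)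
      show "set as \<subseteq> {..<?r}" if "reduced_word as u" for as
        by (rule reduced_word_letters_less[OF r(2,1) that])
      show "filter (\<lambda>x. fst x \<in> {..<?r}) (rows_up ?r 1 ?z Kz @ D_rows ?r var_X N @ rows_down ?r 1 y Ky)
        = filter (\<lambda>x. fst x \<in> {..<?r}) (rows_up n 1 ?z Kz @ D_rows n var_X N @ rows_down n 1 y Ky)"
        unfolding filter_append filter_rows[OF J(1)] filter_rows[OF J(2)]
          filter_D_rows[OF r(1) rn] filter_D_rows[OF r(1) order_refl] ..
    qed
    finally show ?thesis by simp
  qed
  obtain L where L: "mps_tendsto ?G L" using mps_tendsto_factor_coeff_D_rows by blast
  then have "mps_tendsto ?F L" using eq by (rule mps_tendsto_eventually_cong)
  then have "mixed_stanley_I u var_X y z = L" unfolding 1 by (rule mps_lim_eqI)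
  then show ?thesis using L by simp
qed

section \<open>Blocks of variables\<close>

definition block_start :: "(nat \<Rightarrow> nat) \<Rightarrow> nat \<Rightarrow> nat" where
  "block_start c j = (if j = 1 then 0 else c (j - 1))"

text \<open>The product of the series of the \<open>j\<close>-th block, in which every row starts just above \<open>block_start c j\<close>.  The
  number of rows is the size of the block.\<close>

definition block_down :: "nat \<Rightarrow> (nat \<Rightarrow> 'v mps) \<Rightarrow> (nat \<Rightarrow> nat) \<Rightarrow> nat \<Rightarrow> (nat \<times> 'v mps) list" where
  "block_down n v c j = rows_down n (Suc (block_start c j)) (block v c j) (c j - block_start c j)"

definition block_up :: "nat \<Rightarrow> (nat \<Rightarrow> 'v mps) \<Rightarrow> (nat \<Rightarrow> nat) \<Rightarrow> nat \<Rightarrow> (nat \<times> 'v mps) list" where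
  "block_up n v c j = rows_up n (Suc (block_start c j)) (\<lambda>k. - block v c j k) (c j - block_start c j)"

lemma block_eq_0: "c j - block_start c j < k \<Longrightarrow> block v c j k = 0"
  by (auto simp: block_def block_start_def Let_def)

lemma block_down_eq:
  "block_down n v c j = concat (map (\<lambda>i. rev (row n (Suc (block_start c j)) (v i))) [Suc (block_start c j)..<Suc (c j)])"
proof -
  let ?l = "block_start c j"
  have u: "[Suc ?l..<Suc (c j)] = map (\<lambda>k. ?l + k) [1..<Suc (c j - ?l)]"
    by (rule nth_equalityI) (auto simp del: upt_Suc)
  have b: "block v c j k = v (?l + k)" if "k \<in> set [1..<Suc (c j - ?l)]" for k
    using that by (auto simp: block_def block_start_def Let_def simp del: upt_Suc split: if_splits)
  show ?thesis unfolding u block_down_def rows_down_def map_map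
    by (intro arg_cong[of _ _ concat] map_cong) (simp_all only: o_apply b)
qed

text \<open>The row of \<open>v i\<close> starts at \<open>i\<close> in the Schubert polynomial.  Block by block, the rows may be lowered to the start of
  their block, as the letters strictly inside a block are not descents; the rows beyond the last block
  disappear for the same reason.\<close>

lemma factor_coeff_right_blocks:
  assumes p: "1 \<le> p" and mono: "strict_mono_on {1..p} c"
    and nd: "\<And>k as. k \<notin> c ` {1..p} \<Longrightarrow> \<not> reduced_word (as @ [k]) w"
  shows "factor_coeff w [] [] (X @ concat (map (\<lambda>i. rev (row n i (v i))) [1..<n])) =
    factor_coeff w [] [] (X @ concat (map (block_down n v c) [1..<Suc p]))"
proof -
  let ?A = "\<lambda>i. rev (row n i (v i))"
  \<comment> \<open>the last position \<open>c p\<close> may exceed the rank, so the product is extended by empty rows\<close>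
  define M where "M = max (n - 1) (c p)"
  have cm: "c i < c j" if "1 \<le> i" "i < j" "j \<le> p" for i j
    using mono that by (auto simp: strict_mono_on_def)
  have cle: "c i \<le> c j" if "1 \<le> i" "i \<le> j" "j \<le> p" for i j
    using cm[of i j] that by (cases "i = j") auto
  have gap: "\<not> reduced_word (as @ [k]) w" if "1 \<le> j" "j \<le> p" "block_start c j < k" "k < c j" for j k as
  proof (rule nd)
    show "k \<notin> c ` {1..p}"
    proof
      assume "k \<in> c ` {1..p}"
      then obtain i where i: "1 \<le> i" "i \<le> p" "k = c i" by auto
      have "i < j" using i that cle[of j i] by (cases "i < j") auto
      then have "c i \<le> c (j - 1)" "j \<noteq> 1" using cle[of i "j - 1"] i that by auto
      then show False using i that by (simp add: block_start_def)
    qed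
  qed
  have tail: "concat (map ?A [1..<n]) = concat (map ?A [Suc 0..<Suc M])"
  proof (cases "n = 0")
    case False
    have "[Suc 0..<Suc M] = [1..<n] @ [n..<Suc M]"
      using upt_add_eq_append[of 1 n "Suc M - n"] False by (simp add: M_def del: upt_Suc)
    moreover have "concat (map ?A [n..<Suc M]) = []" by (simp add: row_def del: upt_Suc)
    ultimately show ?thesis by (simp del: upt_Suc)
  qed (simp add: row_def del: upt_Suc)
  have "factor_coeff w [] [] (X @ concat (map ?A [Suc 0..<Suc M])) =
    factor_coeff w [] [] (X @ concat (map (block_down n v c) [1..<Suc j]) @ concat (map ?A [Suc (c j)..<Suc M]))"
    if "1 \<le> j" "j \<le> p" for j
    using that
  proof (induction j rule: dec_induct)
    case base
    have l: "block_start c 1 = 0" by (simp add: block_start_def)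
    have b: "concat (map (block_down n v c) [1..<Suc 1])
        = concat (map (\<lambda>i. rev (row n (Suc 0) (v i))) [Suc 0..<Suc (c 1)])"
      unfolding l[symmetric] block_down_eq[symmetric] by simp
    show ?case unfolding b
    proof (rule replace_rows_right)
      show "c 1 \<le> M" using cle[of 1 p] p by (simp add: M_def)
      show "\<not> reduced_word (as @ [k]) w" if "0 < k" "k < c 1" for k as
        using gap[of 1] that l p by simp
    qed simp
  next
    case (step j)
    have l: "block_start c (Suc j) = c j" using step.hyps(1) by (simp add: block_start_def)
    let ?Y = "X @ concat (map (block_down n v c) [1..<Suc j])"
    have "factor_coeff w [] [] (?Y @ concat (map ?A [Suc (c j)..<Suc M])) =
      factor_coeff w [] [] (?Y @ block_down n v c (Suc j) @ concat (map ?A [Suc (c (Suc j))..<Suc M]))"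
      unfolding block_down_eq l
    proof (rule replace_rows_right)
      show "c j \<le> c (Suc j)" using cle[of j "Suc j"] step by simp
      show "c (Suc j) \<le> M" using cle[of "Suc j" p] step by (simp add: M_def)
      show "\<not> reduced_word (as @ [k]) w" if "c j < k" "k < c (Suc j)" for k as
        using gap[of "Suc j"] that l step by simp
    qed
    then show ?case using step by simp
  qed
  from this[OF p order_refl]
  have "factor_coeff w [] [] (X @ concat (map ?A [Suc 0..<Suc M])) =
    factor_coeff w [] [] ((X @ concat (map (block_down n v c) [1..<Suc p])) @ concat (map ?A [Suc (c p)..<Suc M]))"
    by simp
  also have "\<dots> = factor_coeff w [] [] (X @ concat (map (block_down n v c) [1..<Suc p]))"
  proof (rule factor_coeff_drop_right)
    fix k as assume "k \<in> fst ` set (concat (map ?A [Suc (c p)..<Suc M]))"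
    then have "c p < k" by (auto simp: row_def simp del: upt_Suc)
    then have "k \<notin> c ` {1..p}" using cle[of _ p] by force
    then show "\<not> reduced_word (as @ [k]) w" by (rule nd)
  qed
  finally show ?thesis unfolding tail .
qed

lemma factor_equiv_concat_map:
  "(\<And>j. j \<in> set js \<Longrightarrow> factor_equiv (f j) (g j)) \<Longrightarrow> factor_equiv (concat (map f js)) (concat (map g js))"
  by (induction js) (simp_all add: factor_equiv_refl factor_equiv_append)

lemma rev_block_down:
  "factor_equiv (rev (block_down n (\<lambda>k. - v k) c j)) (block_up n v c j)"
proof -
  let ?f = "\<lambda>k. row n (Suc (block_start c j)) (- block v c j k)"
  have b: "block (\<lambda>k. - v k) c j k = - block v c j k" for k
    by (simp add: block_def Let_def)
  have "factor_equiv (concat (map ?f (rev [1..<Suc (c j - block_start c j)]))) (concat (map ?f [1..<Suc (c j - block_start c j)]))"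
    by (intro factor_equiv_sym[OF factor_equiv_concat_rev] factor_equiv_rows) simp
  then show ?thesis
    by (simp add: block_down_def block_up_def rows_down_def rows_up_def rev_concat rev_map o_def b del: upt_Suc)
qed

text \<open>The mirror image of \<open>factor_coeff_right_blocks\<close> under reversal.  Reversal leaves the rows of a block in
  descending order of the variables, and their commutation restores the ascending order.\<close>

lemma factor_coeff_left_blocks:
  assumes w: "bij w" and q: "1 \<le> q" and mono: "strict_mono_on {1..q} c"
    and nd: "\<And>k as. k \<notin> c ` {1..q} \<Longrightarrow> \<not> reduced_word (as @ [k]) (inv w)"
  shows "factor_coeff w [] [] (concat (map (\<lambda>i. row n i (- v i)) (rev [1..<n])) @ X) =
    factor_coeff w [] [] (concat (map (block_up n v c) (rev [1..<Suc q])) @ X)"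
proof -
  let ?A = "\<lambda>i. rev (row n i (- v i))"
  let ?B = "block_down n (\<lambda>k. - v k) c"
  have "factor_coeff w [] [] (concat (map (\<lambda>i. row n i (- v i)) (rev [1..<n])) @ X)
    = factor_coeff (inv w) [] [] (rev X @ concat (map ?A [1..<n]))"
    using factor_coeff_rev[OF w, of "[]" "[]" "concat (map (\<lambda>i. row n i (- v i)) (rev [1..<n])) @ X"]
    by (simp add: rev_concat rev_map o_def del: upt_Suc)
  also have "\<dots> = factor_coeff (inv w) [] [] (rev X @ concat (map ?B [1..<Suc q]))"
    by (rule factor_coeff_right_blocks[OF q mono nd])
  also have "\<dots> = factor_coeff w [] [] ([] @ concat (map (\<lambda>j. rev (?B j)) (rev [1..<Suc q])) @ X)"
    using factor_coeff_rev[OF w, of "[]" "[]" "concat (map (\<lambda>j. rev (?B j)) (rev [1..<Suc q])) @ X"]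
    by (simp add: rev_concat rev_map o_def del: upt_Suc)
  also have "\<dots> = factor_coeff w [] [] ([] @ concat (map (block_up n v c) (rev [1..<Suc q])) @ X)"
    by (intro factor_equiv_factor_coeff factor_equiv_concat_map rev_block_down)
  finally show ?thesis by simp
qed


section \<open>The factorization formula\<close>

lemma factor_coeff_eq_0_fixes_upto:
  assumes "u \<notin> fixes_upto l" "fst ` set L \<subseteq> {l<..}"
  shows "factor_coeff u [] [] L = 0"
proof (rule factor_coeff_eq_0)
  fix as assume "set as \<subseteq> fst ` set L"
  then have "word_perm as \<in> fixes_upto l" using assms(2) by (intro word_perm_in_fixes_upto) auto
  then show "\<not> reduced_word ([] @ as @ []) u" using assms(1) by (auto simp: reduced_word_def)
qed

lemma fst_set_blocks:
  "fst ` set (block_up n v c j) \<subseteq> {block_start c j<..}" "fst ` set (block_down n v c j) \<subseteq> {block_start c j<..}"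
  using fst_set_rows[of n "Suc (block_start c j)"] unfolding block_up_def block_down_def by fastforce+

text \<open>Compatibility of a factorization confines each outer factor to the parabolic subgroup given by the start of
  its block.\<close>

lemma compatible_factorizations_eq:
  "compatible_factorizations w a p b q =
    {us \<in> reduced_factorizations (p + q - 1) w.
      (\<forall>j\<in>{1..q - 1}. factor us j \<in> fixes_upto (block_start b (q + 1 - j))) \<and>
      (\<forall>j\<in>{q + 1..p + q - 1}. factor us j \<in> fixes_upto (block_start a (j - q + 1)))}"
proof -
  have lb: "block_start b (q + 1 - j) = b (q - j)" if "j \<in> {1..q - 1}" for j
    using that by (auto simp: block_start_def)
  have la: "block_start a (j - q + 1) = a (j - q)" if "j \<in> {q + 1..p + q - 1}" for j
    using that by (auto simp: block_start_def)
  have "us \<in> compatible_factorizations w a p b q \<longleftrightarrow> us \<in> reduced_factorizations (p + q - 1) w \<and>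
      (\<forall>j\<in>{1..q - 1}. factor us j \<in> fixes_upto (b (q - j))) \<and>
      (\<forall>j\<in>{q + 1..p + q - 1}. factor us j \<in> fixes_upto (a (j - q)))" (is "?L \<longleftrightarrow> ?R") for us
  proof
    assume ?L
    then show ?R
      by (auto simp: compatible_factorizations_def reduced_factorizations_def fixes_upto_def)
  next
    assume R: ?R
    have 1: "factor us j \<in> fixes_upto (b (q - j))" if "1 \<le> j" "j < q" for j
      using R that by auto
    have 2: "factor us j \<in> fixes_upto (a (j - q))" if "q < j" "j \<le> p + q - 1" for j
      using R that by auto
    show ?L
      unfolding compatible_factorizations_def
    proof (intro CollectI conjI ballI allI impI)
      show "length us = p + q - 1" "reduced_factorization us w"
        using R by (auto simp: reduced_factorizations_def)
      fix j assume j: "j \<in> {1..p + q - 1}"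
      show "factor us j \<in> S_inf" if "j \<noteq> q"
        using j that 1[of j] 2[of j] by (cases "j < q") (auto simp: fixes_upto_def)
      fix i
      show "factor us j (int i) = int i" if "j < q \<and> 1 \<le> i \<and> i \<le> b (q - j)"
        using j that 1[of j] by (auto simp: fixes_upto_def)
      show "factor us j (int i) = int i" if "q < j \<and> 1 \<le> i \<and> i \<le> a (j - q)"
        using j that 2[of j] by (auto simp: fixes_upto_def)
    qed
  qed
  then show ?thesis using la lb by auto
qed

lemma not_reduced_word_snoc_of_compatible:
  assumes "compatible w c p" "k \<notin> c ` {1..p}"
  shows "\<not> reduced_word (as @ [k]) w"
  using assms reduced_word_snocD(1) by (auto simp: compatible_def)

text \<open>Here compatibility of \<open>w\<close> and of its inverse enters, as the absence of descents strictly inside the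
  blocks.\<close>

lemma schubert_D_eq_lim_blocks:
  assumes p: "1 \<le> p" "strict_mono_on {1..p} a" "compatible w a p"
    and q: "1 \<le> q" "strict_mono_on {1..q} b" "compatible (inv w) b q"
    and w: "w \<in> WD_inf"
  shows "schubert_D w x y z = mps_lim (\<lambda>N. factor_coeff w [] [] (concat (map (block_up (rank w) z b) (rev [1..<Suc q]))
     @ D_rows (rank w) x N @ concat (map (block_down (rank w) y a) [1..<Suc p])))"
proof -
  let ?n = "rank w"
  let ?Z = "concat (map (\<lambda>i. row ?n i (- z i)) (rev [1..<?n]))"
  let ?Y = "concat (map (\<lambda>i. rev (row ?n i (y i))) [1..<?n])"
  note n = rank_WD[OF w]
  have letters: "fst ` set (?Z @ D_rows ?n x N @ ?Y) \<subseteq> {..<?n}" for N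
    using fst_set_D_rows[OF n(1), of x N] by (auto simp: row_def)
  have "schubert_D w x y z = mps_lim (\<lambda>N. factor_coeff w [] [] (?Z @ D_rows ?n x N @ ?Y))"
    using nc_coeff_factor_prod[OF n letters]
    by (simp add: schubert_D_def ser_factor_prod Let_def D_rows_def)
  also have "\<dots> = mps_lim (\<lambda>N. factor_coeff w [] [] (concat (map (block_up ?n z b) (rev [1..<Suc q]))
     @ D_rows ?n x N @ concat (map (block_down ?n y a) [1..<Suc p])))"
  proof (intro arg_cong[of _ _ mps_lim] ext)
    fix N
    have "factor_coeff w [] [] (?Z @ D_rows ?n x N @ ?Y) =
      factor_coeff w [] [] (concat (map (block_up ?n z b) (rev [1..<Suc q])) @ D_rows ?n x N @ ?Y)"
      by (rule factor_coeff_left_blocks[OF WD_inf_bij[OF w] q(1,2)])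
        (rule not_reduced_word_snoc_of_compatible[OF q(3)])
    also have "\<dots> = factor_coeff w [] [] ((concat (map (block_up ?n z b) (rev [1..<Suc q])) @ D_rows ?n x N) @ ?Y)"
      by simp
    also have "\<dots> = factor_coeff w [] [] ((concat (map (block_up ?n z b) (rev [1..<Suc q])) @ D_rows ?n x N)
        @ concat (map (block_down ?n y a) [1..<Suc p]))"
      by (rule factor_coeff_right_blocks[OF p(1,2)]) (rule not_reduced_word_snoc_of_compatible[OF p(3)])
    finally show "factor_coeff w [] [] (?Z @ D_rows ?n x N @ ?Y) = factor_coeff w [] [] (concat (map (block_up ?n z b) (rev [1..<Suc q]))
     @ D_rows ?n x N @ concat (map (block_down ?n y a) [1..<Suc p]))" by simp
  qed
  finally show ?thesis .
qed

theorem proposition4p13: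
  fixes a b :: "nat \<Rightarrow> nat" and p q :: nat and w :: "int \<Rightarrow> int"
  assumes "p \<ge> 1" and "q \<ge> 1"
    and "strict_mono_on {1..p} a" and "strict_mono_on {1..q} b"
    and "a 1 \<noteq> 1"
    and "w \<in> WD_inf"
    and "compatible w a p" and "compatible (inv w) b q"
  shows "schubert_D w var_X var_Y var_Z =
    (\<Sum>us \<in> compatible_factorizations w a p b q.
       (\<Prod>j = 1..q - 1. double_stanley_G (factor us j) (\<lambda>_. 0) (block var_Z b (q + 1 - j)))
       * mixed_stanley_I (factor us q) var_X (block var_Y a 1) (block var_Z b 1)
       * (\<Prod>j = q + 1..p + q - 1. stanley_G (factor us j) (block var_Y a (j - q + 1))))"
proof -
  note w = \<open>w \<in> WD_inf\<close> and p = \<open>p \<ge> 1\<close> and q = \<open>q \<ge> 1\<close>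
  define n where "n = rank w"
  have n: "2 \<le> n" "w \<in> WD n" unfolding n_def using rank_WD[OF w] by auto
  let ?RZ = "block_up n var_Z b" and ?RY = "block_down n var_Y a"
  let ?mid = "\<lambda>N. ?RZ 1 @ D_rows n var_X N @ ?RY 1"
  \<comment> \<open>one list of factors for each member \<open>u\<^sub>1, \<dots>, u\<^sub>p\<^sub>+\<^sub>q\<^sub>-\<^sub>1\<close> of a factorization\<close>
  define Ls where "Ls N = map ?RZ (rev [2..<Suc q]) @ [?mid N] @ map ?RY [2..<Suc p]" for N
  have len: "length (Ls N) = p + q - 1" for N using p q by (auto simp: Ls_def simp del: upt_Suc)
  have concat: "concat (map ?RZ (rev [1..<Suc q])) @ D_rows n var_X N @ concat (map ?RY [1..<Suc p]) = concat (Ls N)" for N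
  proof -
    have "[1..<Suc q] = 1 # [2..<Suc q]" "[1..<Suc p] = 1 # [2..<Suc p]"
      using p q by (simp_all add: upt_conv_Cons numeral_2_eq_2 del: upt_Suc)
    then show ?thesis by (simp add: Ls_def del: upt_Suc)
  qed
  have nth: "Ls N ! (j - 1) = (if j < q then ?RZ (q + 1 - j) else if j = q then ?mid N else ?RY (j - q + 1))"
    if "j \<in> {1..p + q - 1}" for j N
  proof -
    consider "j < q" | "j = q" | "q < j" by linarith
    then show ?thesis
    proof cases
      case 1
      then have "[2..<Suc q] ! (q - 1 - Suc (j - 1)) = q + 1 - j" using that by (subst nth_upt) auto
      moreover have "j - Suc 0 < q - Suc 0" "q - Suc j < length [2..<Suc q]" using 1 that by auto
      ultimately show ?thesis using 1 that by (simp add: Ls_def nth_append rev_nth rev_map[symmetric] del: upt_Suc)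
    next
      case 2
      then show ?thesis using that by (simp add: Ls_def nth_append del: upt_Suc)
    next
      case 3
      define i where "i = j - q - 1"
      have j: "j - 1 = (q - 1) + Suc i" "j - q + 1 = 2 + i" "i < p - 1" using 3 that q by (auto simp: i_def)
      moreover have "\<not> Suc (q + i - Suc 0) < q - Suc 0" by simp
      ultimately show ?thesis using 3 by (simp add: Ls_def nth_append del: upt_Suc)
    qed
  qed
  let ?CF = "compatible_factorizations w a p b q" and ?RF = "reduced_factorizations (p + q - 1) w"
  let ?GZ = "\<lambda>us. \<Prod>j = 1..q - 1. double_stanley_G (factor us j) (\<lambda>_. 0) (block var_Z b (q + 1 - j))"
  let ?GY = "\<lambda>us. \<Prod>j = q + 1..p + q - 1. stanley_G (factor us j) (block var_Y a (j - q + 1))"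
  let ?E = "\<lambda>us N j. factor_coeff (factor us j) [] [] (Ls N ! (j - 1))"
  have interval: "{1..p + q - 1} = {1..q - 1} \<union> {q} \<union> {q + 1..p + q - 1}" using p q by auto
  have prod_split: "(\<Prod>i<p + q - 1. factor_coeff (us ! i) [] [] (Ls N ! i)) =
      (\<Prod>j = 1..q - 1. ?E us N j) * ?E us N q * (\<Prod>j = q + 1..p + q - 1. ?E us N j)" for us N
  proof -
    have "(\<Prod>i<p + q - 1. factor_coeff (us ! i) [] [] (Ls N ! i)) = (\<Prod>j = 1..p + q - 1. ?E us N j)"
      by (rule prod.reindex_bij_witness[of _ "\<lambda>j. j - 1" Suc]) (auto simp: factor_def)
    also have "\<dots> = (\<Prod>j = 1..q - 1. ?E us N j) * ?E us N q * (\<Prod>j = q + 1..p + q - 1. ?E us N j)"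
      unfolding interval using q by (subst prod.union_disjoint; simp?; subst prod.union_disjoint; auto)
    finally show ?thesis .
  qed
  have factor_WD: "factor us j \<in> WD n" if "us \<in> ?RF" "j \<in> {1..p + q - 1}" for us j
  proof -
    have "factor us j \<in> set us" using that by (auto simp: factor_def reduced_factorizations_def)
    then show ?thesis using reduced_factorization_WD[OF _ n(2,1), of us] that
      by (auto simp: reduced_factorizations_def)
  qed
  have expansion: "factor_coeff w [] [] (concat (Ls N)) =
      (\<Sum>us\<in>?CF. ?GZ us * factor_coeff (factor us q) [] [] (?mid N) * ?GY us)" for N
  proof -
    have "factor_coeff w [] [] (concat (Ls N)) =
      (\<Sum>us\<in>?RF. (\<Prod>j = 1..q - 1. ?E us N j) * ?E us N q * (\<Prod>j = q + 1..p + q - 1. ?E us N j))"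
      using factor_coeff_concat[OF w, of "Ls N"] unfolding len prod_split .
    \<comment> \<open>the list of an outer block has letters above its start only, which kills all other factorizations\<close>
    also have "\<dots> = (\<Sum>us\<in>?CF. (\<Prod>j = 1..q - 1. ?E us N j) * ?E us N q * (\<Prod>j = q + 1..p + q - 1. ?E us N j))"
    proof (rule sum.mono_neutral_right)
      show "finite ?RF" by (rule finite_reduced_factorizations[OF w])
      show "?CF \<subseteq> ?RF" unfolding compatible_factorizations_eq by blast
      show "\<forall>us\<in>?RF - ?CF. (\<Prod>j = 1..q - 1. ?E us N j) * ?E us N q * (\<Prod>j = q + 1..p + q - 1. ?E us N j) = 0"
      proof
        fix us assume "us \<in> ?RF - ?CF"
        then consider j where "j \<in> {1..q - 1}" "factor us j \<notin> fixes_upto (block_start b (q + 1 - j))"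
          | j where "j \<in> {q + 1..p + q - 1}" "factor us j \<notin> fixes_upto (block_start a (j - q + 1))"
          unfolding compatible_factorizations_eq by blast
        then show "(\<Prod>j = 1..q - 1. ?E us N j) * ?E us N q * (\<Prod>j = q + 1..p + q - 1. ?E us N j) = 0"
        proof cases
          case 1
          then have "?E us N j = 0"
            using factor_coeff_eq_0_fixes_upto[OF 1(2) fst_set_blocks(1)] p q by (subst nth) auto
          then have "(\<Prod>j = 1..q - 1. ?E us N j) = 0" using 1(1) by (intro prod_zero) auto
          then show ?thesis by simp
        next
          case 2
          then have "?E us N j = 0"
            using factor_coeff_eq_0_fixes_upto[OF 2(2) fst_set_blocks(2)] p q by (subst nth) auto
          then have "(\<Prod>j = q + 1..p + q - 1. ?E us N j) = 0" using 2(1) by (intro prod_zero) auto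
          then show ?thesis by simp
        qed
      qed
    qed
    also have "\<dots> = (\<Sum>us\<in>?CF. ?GZ us * factor_coeff (factor us q) [] [] (?mid N) * ?GY us)"
    proof (rule sum.cong[OF refl])
      fix us assume us: "us \<in> ?CF"
      then have RF: "us \<in> ?RF"
        and fZ: "\<And>j. j \<in> {1..q - 1} \<Longrightarrow> factor us j \<in> fixes_upto (block_start b (q + 1 - j))"
        and fY: "\<And>j. j \<in> {q + 1..p + q - 1} \<Longrightarrow> factor us j \<in> fixes_upto (block_start a (j - q + 1))"
        unfolding compatible_factorizations_eq by blast+
      have "(\<Prod>j = 1..q - 1. ?E us N j) = ?GZ us"
      proof (rule prod.cong[OF refl])
        fix j assume j: "j \<in> {1..q - 1}"
        then have j': "j \<in> {1..p + q - 1}" "j < q" using p q by auto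
        show "?E us N j = double_stanley_G (factor us j) (\<lambda>_. 0) (block var_Z b (q + 1 - j))"
          unfolding nth[OF j'(1)]
          using double_stanley_G_eq_factor_coeff[OF fZ[OF j] n(1) factor_WD[OF RF j'(1)]
              block_eq_0[of b "q + 1 - j" _ var_Z]] j'(2)
          by (simp add: block_up_def)
      qed
      moreover have "(\<Prod>j = q + 1..p + q - 1. ?E us N j) = ?GY us"
      proof (rule prod.cong[OF refl])
        fix j assume j: "j \<in> {q + 1..p + q - 1}"
        then have j': "j \<in> {1..p + q - 1}" "q < j" using p q by auto
        show "?E us N j = stanley_G (factor us j) (block var_Y a (j - q + 1))"
          unfolding nth[OF j'(1)]
          using stanley_G_eq_factor_coeff[OF fY[OF j] n(1) factor_WD[OF RF j'(1)]
              block_eq_0[of a "j - q + 1" _ var_Y]] j'(2)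
          by (simp add: block_down_def)
      qed
      moreover have "?E us N q = factor_coeff (factor us q) [] [] (?mid N)"
        using p q by (subst nth) auto
      ultimately show "(\<Prod>j = 1..q - 1. ?E us N j) * ?E us N q * (\<Prod>j = q + 1..p + q - 1. ?E us N j)
        = ?GZ us * factor_coeff (factor us q) [] [] (?mid N) * ?GY us" by simp
    qed
    finally show ?thesis .
  qed
  \<comment> \<open>the only factor that still depends on \<open>N\<close> is the one in the middle\<close>
  have lim: "mps_tendsto (\<lambda>N. factor_coeff (factor us q) [] [] (?mid N))
      (mixed_stanley_I (factor us q) var_X (block var_Y a 1) (block var_Z b 1))" if "us \<in> ?CF" for us
  proof -
    have "us \<in> ?RF" using that unfolding compatible_factorizations_eq by blast
    then have u: "factor us q \<in> WD n" using p q by (intro factor_WD) auto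
    have l: "Suc (block_start c 1) = 1" for c by (simp add: block_start_def)
    show ?thesis
      unfolding block_up_def block_down_def l
      by (rule mixed_stanley_I_tendsto[OF n(1) u block_eq_0 block_eq_0])
  qed
  have "schubert_D w var_X var_Y var_Z = mps_lim (\<lambda>N. factor_coeff w [] [] (concat (Ls N)))"
    using schubert_D_eq_lim_blocks[OF p assms(3,7) q assms(4,8) w, of var_X var_Y var_Z]
    unfolding n_def[symmetric] concat .
  also have "\<dots> = (\<Sum>us\<in>?CF. ?GZ us * mixed_stanley_I (factor us q) var_X (block var_Y a 1) (block var_Z b 1) * ?GY us)"
    unfolding expansion
    by (intro mps_lim_eqI mps_tendsto_sum mps_tendsto_mult mps_tendsto_const lim)
  finally show ?thesis .
qed

end
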